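(* For every integer $d\geq 2$, the set $\{\bar\omega(\Lambda) : \Lambda \text{ is a full-rank lattice in } \mathbb{R}^d\}$ is equal to $[0,+\infty]$.
   Context: For $\vec x=(x_1,\ldots,x_d)\in\mathbb{R}^d$ set $|\vec x|=\max_{1\le i\le d}|x_i|$ and $\Pi(\vec x)=\prod_{i=1}^d|x_i|^{1/d}$. For a full-rank lattice $\Lambda\subset\mathbb{R}^d$ and $t>0$ (large enough that the minimum is over a nonempty set) set $\psi_\Lambda(t)=\min\{\Pi(\vec x): \vec x\in\Lambda,\ 0<|\vec x|\le t\}$. The (weak) uniform Diophantine exponent of $\Lambda$ is $\bar\omega(\Lambda)=\sup\{\gamma\in\mathbb{R} : \limsup_{t\to+\infty} t^\gamma\psi_\Lambda(t)<+\infty\}$, a value in $[0,+\infty]$. *)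

theory Defs
  imports "HOL-Analysis.Analysis"
begin

definition full_rank_lattice :: "(real ^ 'n) set \<Rightarrow> bool" where
  "full_rank_lattice L \<longleftrightarrow>
     (\<exists>B. independent B \<and> span B = UNIV \<and>
          L = {\<Sum>b\<in>B. of_int (k b) *\<^sub>R b | k :: real ^ 'n \<Rightarrow> int. True})"

definition geo_prod :: "real ^ 'n \<Rightarrow> real" where
  "geo_prod x = (\<Prod>i\<in>UNIV. \<bar>x $ i\<bar> powr (1 / real CARD('n)))"

text \<open>On \<^typ>\<open>real ^ 'n\<close> the library's \<^const>\<open>infnorm\<close> is the maximum of the absolute values of the
  coordinates. For a lattice the set below is finite, and it is nonempty for large \<^term>\<open>t\<close>; the
  unspecified value of \<^const>\<open>Min\<close> for small \<^term>\<open>t\<close> does not affect the exponent.\<close>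

definition lattice_psi :: "(real ^ 'n) set \<Rightarrow> real \<Rightarrow> real" where
  "lattice_psi L t = Min {geo_prod x | x. x \<in> L \<and> 0 < infnorm x \<and> infnorm x \<le> t}"

definition weak_uniform_exponent :: "(real ^ 'n) set \<Rightarrow> ereal" where
  "weak_uniform_exponent L =
     Sup {ereal \<gamma> | \<gamma>. Limsup at_top (\<lambda>t. ereal (t powr \<gamma> * lattice_psi L t)) < \<infinity>}"

end

theory Submission
  imports Defs "HOL-Computational_Algebra.Polynomial_Factorial" "HOL-Real_Asymp.Real_Asymp"
begin

text \<open>The value \<open>\<infinity>\<close> is attained by the integer lattice. For finite \<open>\<omega>\<close>, start from the lattice \<open>L\<close> of
  conjugate vectors of integers of a totally real field of degree \<open>d\<close>, on which the product \<open>N\<close> of the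
  absolute values of the coordinates is at least 1 off the origin, and replace two coordinates
  \<open>x\<^sub>i, x\<^sub>j\<close> by \<open>x\<^sub>i - s x\<^sub>j\<close> and \<open>x\<^sub>i - u x\<^sub>j\<close> with \<open>s \<in> [1, 2]\<close>, \<open>u \<in> [3, 4]\<close>. With
  \<open>\<rho> = x\<^sub>i / x\<^sub>j\<close>, the new product is at least a constant times the minimum of \<open>1\<close>, \<open>\<bar>s - \<rho>\<bar> N\<close> and
  \<open>\<bar>u - \<rho>\<bar> N\<close>, because \<open>\<rho>\<close> cannot be close to both slopes; so \<open>s\<close> and \<open>u\<close> can be treated separately. Since the sum of \<open>1 / N\<close> over the points of norm at most \<open>T\<close> grows slower than
  any power of \<open>T\<close>, most \<open>s\<close> satisfy \<open>\<bar>s - \<rho>\<bar> N \<ge> T powr - \<delta>\<close> at all these points.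

  Nested intervals for \<open>s\<close> and \<open>u\<close> are chosen alternately. If \<open>s\<close> lies near the ratio of a point \<open>v\<close>, put it
  at distance about \<open>T powr - (d * \<omega>)\<close> from that ratio, outside the small set of slopes that are too close
  to the ratio of any point of norm at most \<open>T\<close>; and move \<open>u\<close> to the ratio of a point \<open>w\<close> of
  norm slightly larger than \<open>T\<close>, found by the pigeonhole principle near a slope that is equally far from all
  ratios. Then \<open>v\<close> makes the product small enough up to the moment when \<open>w\<close> becomes available, and at time
  \<open>T\<close> no point does better.\<close>

section \<open>Lattices and their exponents\<close>

text \<open>The functionals dual to the basis are bounded by constants times the norm, so a bounded
  lattice point has bounded integer coefficients, and only finitely many coefficient tuples
  remain.\<close>

lemma full_rank_lattice_finite:
  fixes L :: "(real ^ 'n) set"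
  assumes "full_rank_lattice L"
  shows "finite {x \<in> L. infnorm x \<le> t}"
proof -
  obtain B where B: "independent B" "span B = UNIV"
    and L: "L = {\<Sum>b\<in>B. of_int (k b) *\<^sub>R b | k :: real ^ 'n \<Rightarrow> int. True}"
    using assms unfolding full_rank_lattice_def by blast
  have finB: "finite B" using B(1) independent_bound by blast
  have "\<forall>b. \<exists>g C. linear (g :: real ^ 'n \<Rightarrow> real) \<and> (\<forall>x\<in>B. g x = (if x = b then 1 else 0))
          \<and> C > 0 \<and> (\<forall>x. \<bar>g x\<bar> \<le> C * infnorm x)"
  proof
    fix b
    obtain g :: "real ^ 'n \<Rightarrow> real" where g: "linear g" "\<forall>x\<in>B. g x = (if x = b then 1 else 0)"
      using linear_independent_extend[OF B(1), of "\<lambda>x. if x = b then 1 else 0"] by blast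
    obtain C where C: "C > 0" "\<And>x. norm (g x) \<le> C * norm x"
      using linear_bounded_pos[OF g(1)] by blast
    have "\<bar>g x\<bar> \<le> C * sqrt DIM(real ^ 'n) * infnorm x" for x
      using order.trans[OF C(2)[of x] mult_left_mono[OF norm_le_infnorm[of x]]] C(1)
      by (simp add: mult.assoc)
    moreover have "C * sqrt DIM(real ^ 'n) > 0" using C by simp
    ultimately show "\<exists>g C. linear (g :: real ^ 'n \<Rightarrow> real) \<and> (\<forall>x\<in>B. g x = (if x = b then 1 else 0))
          \<and> C > 0 \<and> (\<forall>x. \<bar>g x\<bar> \<le> C * infnorm x)" using g by blast
  qed
  then obtain g C where g: "\<And>b. linear (g b :: real ^ 'n \<Rightarrow> real)"
    "\<And>b x. x \<in> B \<Longrightarrow> g b x = (if x = b then 1 else 0)"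
    "\<And>b. C b > 0" "\<And>b x. \<bar>g b x\<bar> \<le> C b * infnorm x" by metis
  define R where "R = (\<lambda>b. {- \<lceil>C b * t\<rceil>..\<lceil>C b * t\<rceil>})"
  have "{x \<in> L. infnorm x \<le> t} \<subseteq> (\<lambda>k. \<Sum>b\<in>B. of_int (k b) *\<^sub>R b) ` (PiE B R)"
  proof
    fix x assume "x \<in> {x \<in> L. infnorm x \<le> t}"
    then obtain k :: "real ^ 'n \<Rightarrow> int" where x: "x = (\<Sum>b\<in>B. of_int (k b) *\<^sub>R b)" "infnorm x \<le> t"
      unfolding L by blast
    have "k b \<in> R b" if "b \<in> B" for b
    proof -
      have "g b x = (\<Sum>c\<in>B. of_int (k c) * g b c)"
        unfolding x(1) linear_sum[OF g(1)] by (simp add: linear_cmul[OF g(1)])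
      also have "\<dots> = (\<Sum>c\<in>B. if c = b then of_int (k c) else 0)"
        by (intro sum.cong) (auto simp: g(2))
      also have "\<dots> = of_int (k b)" using that finB by simp
      finally have "\<bar>of_int (k b)\<bar> \<le> C b * t"
        using order.trans[OF g(4)[of b x] mult_left_mono[OF x(2)]] g(3)[of b] by simp
      then have "\<bar>k b\<bar> \<le> \<lceil>C b * t\<rceil>" by (simp add: le_ceiling_iff)
      then show ?thesis by (auto simp: R_def)
    qed
    then have "restrict k B \<in> PiE B R" by auto
    moreover have "x = (\<Sum>b\<in>B. of_int (restrict k B b) *\<^sub>R b)" unfolding x by simp
    ultimately show "x \<in> (\<lambda>k. \<Sum>b\<in>B. of_int (k b) *\<^sub>R b) ` (PiE B R)" by blast
  qed
  moreover have "finite (PiE B R)" using finB by (intro finite_PiE) (auto simp: R_def)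
  ultimately show ?thesis by (meson finite_imageI finite_subset)
qed

lemma full_rank_lattice_diff:
  assumes "full_rank_lattice L" "x \<in> L" "y \<in> L"
  shows "x - y \<in> L"
proof -
  obtain B where L: "L = {\<Sum>b\<in>B. of_int (k b) *\<^sub>R b | k :: real ^ 'a \<Rightarrow> int. True}"
    using assms unfolding full_rank_lattice_def by blast
  obtain k l :: "real ^ 'a \<Rightarrow> int" where
    "x = (\<Sum>b\<in>B. of_int (k b) *\<^sub>R b)" "y = (\<Sum>b\<in>B. of_int (l b) *\<^sub>R b)"
    using assms unfolding L by blast
  then have "x - y = (\<Sum>b\<in>B. of_int (k b - l b) *\<^sub>R b)"
    by (simp add: sum_subtractf scaleR_left_diff_distrib)
  then show ?thesis unfolding L by (intro CollectI exI[of _ "\<lambda>b. k b - l b"]) auto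
qed

lemma full_rank_lattice_image:
  fixes g :: "real ^ 'n \<Rightarrow> real ^ 'n"
  assumes "full_rank_lattice L" "linear g" "inj g"
  shows "full_rank_lattice (g ` L)"
proof -
  obtain B where B: "independent B" "span B = UNIV"
    and L: "L = {\<Sum>b\<in>B. of_int (k b) *\<^sub>R b | k :: real ^ 'n \<Rightarrow> int. True}"
    using assms unfolding full_rank_lattice_def by blast
  have inj: "inj_on g A" for A using assms(3) by (rule inj_on_subset) simp
  have "independent (g ` B)"
    using linear_independent_injective_image[OF assms(2) B(1)] inj by blast
  moreover have "span (g ` B) = UNIV"
    using linear_injective_imp_surjective[OF assms(2,3)] linear_span_image[OF assms(2)] B(2) by simp
  moreover have "g ` L = {\<Sum>b\<in>g ` B. of_int (k b) *\<^sub>R b | k :: real ^ 'n \<Rightarrow> int. True}"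
  proof (intro equalityI subsetI)
    fix y assume "y \<in> g ` L"
    then obtain k :: "real ^ 'n \<Rightarrow> int" where "y = g (\<Sum>b\<in>B. of_int (k b) *\<^sub>R b)"
      unfolding L by blast
    also have "\<dots> = (\<Sum>b\<in>B. of_int ((k \<circ> inv g) (g b)) *\<^sub>R g b)"
      by (simp add: linear_sum[OF assms(2)] linear_cmul[OF assms(2)] assms(3))
    also have "\<dots> = (\<Sum>b\<in>g ` B. of_int ((k \<circ> inv g) b) *\<^sub>R b)"
      by (simp add: sum.reindex[OF inj])
    finally show "y \<in> {\<Sum>b\<in>g ` B. of_int (k b) *\<^sub>R b | k :: real ^ 'n \<Rightarrow> int. True}" by blast
  next
    fix y assume "y \<in> {\<Sum>b\<in>g ` B. of_int (k b) *\<^sub>R b | k :: real ^ 'n \<Rightarrow> int. True}"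
    then obtain k :: "real ^ 'n \<Rightarrow> int" where "y = (\<Sum>b\<in>g ` B. of_int (k b) *\<^sub>R b)" by blast
    also have "\<dots> = g (\<Sum>b\<in>B. of_int ((k \<circ> g) b) *\<^sub>R b)"
      by (simp add: sum.reindex[OF inj] linear_sum[OF assms(2)] linear_cmul[OF assms(2)])
    finally show "y \<in> g ` L" unfolding L by blast
  qed
  ultimately show ?thesis unfolding full_rank_lattice_def by blast
qed

lemma full_rank_lattice_integer_points:
  "full_rank_lattice {x :: real ^ 'n. \<forall>i. x $ i \<in> \<int>}"
proof -
  have Bas: "(Basis :: (real ^ 'n) set) = range (\<lambda>i. axis i 1)"
    by (auto simp: Basis_vec_def)
  have inj: "inj (\<lambda>i::'n. axis i (1::real))"
    by (auto simp: inj_on_def axis_eq_axis)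
  have sum_eq: "(\<Sum>b\<in>Basis. of_int (k b) *\<^sub>R b) = (\<chi> i. of_int (k (axis i 1)))" for k :: "real ^ 'n \<Rightarrow> int"
  proof -
    have "(\<Sum>b\<in>Basis. of_int (k b) *\<^sub>R b) = (\<Sum>i\<in>UNIV. of_int (k (axis i 1)) *\<^sub>R (axis i 1 :: real ^ 'n))"
      unfolding Bas by (simp add: sum.reindex[OF inj])
    also have "\<dots> = (\<chi> i. of_int (k (axis i 1)))"
      by (simp add: vec_eq_iff axis_def if_distrib[of "\<lambda>x. _ * x"] cong: if_cong)
    finally show ?thesis .
  qed
  have "{x :: real ^ 'n. \<forall>i. x $ i \<in> \<int>} = {\<Sum>b\<in>Basis. of_int (k b) *\<^sub>R b | k :: real ^ 'n \<Rightarrow> int. True}"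
    unfolding sum_eq
  proof (intro equalityI subsetI)
    fix x :: "real ^ 'n" assume "x \<in> {x. \<forall>i. x $ i \<in> \<int>}"
    then have "\<forall>i. \<exists>m. x $ i = of_int m" by (auto elim!: Ints_cases)
    then obtain m where m: "\<And>i. x $ i = of_int (m i)" by metis
    \<comment> \<open>\<open>inv\<close> turns a basis vector \<open>axis i 1\<close> back into its
      index \<open>i\<close>.\<close>
    have "x = (\<chi> i. of_int ((m \<circ> inv (\<lambda>i. axis i 1)) (axis i (1::real))))"
      using inv_f_f[OF inj] by (simp add: vec_eq_iff m)
    then show "x \<in> {\<chi> i. of_int (k (axis i 1)) | k :: real ^ 'n \<Rightarrow> int. True}" by blast
  qed auto
  then show ?thesis unfolding full_rank_lattice_def
    using independent_Basis span_Basis by blast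
qed

lemma full_rank_lattice_nonzero:
  fixes L :: "(real ^ 'n) set"
  assumes "full_rank_lattice L"
  obtains x where "x \<in> L" "x \<noteq> 0"
proof -
  obtain B where B: "independent B" "span B = UNIV"
    and L: "L = {\<Sum>b\<in>B. of_int (k b) *\<^sub>R b | k :: real ^ 'n \<Rightarrow> int. True}"
    using assms unfolding full_rank_lattice_def by blast
  have finB: "finite B" using B(1) independent_bound by blast
  have "B \<noteq> {}" using B(2) by (metis UNIV_not_singleton span_empty)
  then obtain b where b: "b \<in> B" by blast
  have "(\<Sum>c\<in>B. of_int (if c = b then 1 else 0) *\<^sub>R c) = (\<Sum>c\<in>B. if c = b then c else 0)"
    by (intro sum.cong) auto
  also have "\<dots> = b" using b finB by simp
  finally have "b = (\<Sum>c\<in>B. of_int (if c = b then 1 else 0) *\<^sub>R c)" by simp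
  then have "b \<in> L" unfolding L by (intro CollectI exI[of _ "\<lambda>c. if c = b then 1 else 0"]) simp
  moreover have "b \<noteq> 0" using B(1) b dependent_zero by blast
  ultimately show ?thesis using that by blast
qed

section \<open>The minimum function and its growth exponent\<close>

lemma lattice_psi_le:
  fixes L :: "(real ^ 'n) set"
  assumes "full_rank_lattice L" "x \<in> L" "x \<noteq> 0" "infnorm x \<le> t"
  shows "lattice_psi L t \<le> geo_prod x"
proof -
  have "{geo_prod x | x. x \<in> L \<and> 0 < infnorm x \<and> infnorm x \<le> t} \<subseteq> geo_prod ` {x \<in> L. infnorm x \<le> t}"
    by blast
  then have "finite {geo_prod x | x. x \<in> L \<and> 0 < infnorm x \<and> infnorm x \<le> t}"
    using full_rank_lattice_finite[OF assms(1), of t] finite_surj by blast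
  then show ?thesis unfolding lattice_psi_def
    using assms by (intro Min_le) (auto simp: infnorm_pos_lt)
qed

text \<open>The point \<open>x\<close> makes the set nonempty, so that \<open>Min\<close> is a
  genuine minimum over a finite nonempty set.\<close>

lemma lattice_psi_ge:
  fixes L :: "(real ^ 'n) set"
  assumes "full_rank_lattice L" "x \<in> L" "x \<noteq> 0" "infnorm x \<le> t"
    and "\<And>y. y \<in> L \<Longrightarrow> y \<noteq> 0 \<Longrightarrow> infnorm y \<le> t \<Longrightarrow> c \<le> geo_prod y"
  shows "c \<le> lattice_psi L t"
proof -
  have "{geo_prod x | x. x \<in> L \<and> 0 < infnorm x \<and> infnorm x \<le> t} \<subseteq> geo_prod ` {x \<in> L. infnorm x \<le> t}"
    by blast
  then have "finite {geo_prod x | x. x \<in> L \<and> 0 < infnorm x \<and> infnorm x \<le> t}"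
    using full_rank_lattice_finite[OF assms(1), of t] finite_surj by blast
  then show ?thesis unfolding lattice_psi_def
    using assms(2-) by (subst Min_ge_iff) (auto simp: infnorm_pos_lt)
qed

lemma geo_prod_eq:
  fixes x :: "real ^ 'n"
  shows "geo_prod x = \<bar>\<Prod>i\<in>UNIV. x $ i\<bar> powr (1 / real CARD('n))"
  unfolding geo_prod_def abs_prod by (rule prod_powr_distrib[symmetric])

lemma geo_prod_nonneg: "0 \<le> geo_prod x"
  by (simp add: geo_prod_eq)

text \<open>A fixed nonzero point bounds the minimum for all large \<open>t\<close>, so the exponent
  0 is admissible.\<close>

lemma weak_uniform_exponent_nonneg:
  fixes L :: "(real ^ 'n) set"
  assumes "full_rank_lattice L"
  shows "0 \<le> weak_uniform_exponent L"
proof -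
  obtain x where x: "x \<in> L" "x \<noteq> 0" using full_rank_lattice_nonzero[OF assms] .
  have "eventually (\<lambda>t. ereal (t powr 0 * lattice_psi L t) \<le> ereal (geo_prod x)) at_top"
    using eventually_ge_at_top[of "max 1 (infnorm x)"]
    by eventually_elim (use lattice_psi_le[OF assms x] in auto)
  then have "Limsup at_top (\<lambda>t. ereal (t powr 0 * lattice_psi L t)) \<le> ereal (geo_prod x)"
    by (rule Limsup_bounded)
  then have "Limsup at_top (\<lambda>t. ereal (t powr 0 * lattice_psi L t)) < \<infinity>"
    by (rule le_less_trans) simp
  then have "ereal 0 \<le> weak_uniform_exponent L"
    unfolding weak_uniform_exponent_def by (intro Sup_upper) blast
  then show ?thesis by (simp add: zero_ereal_def)
qed

text \<open>Only exponents strictly below or strictly above \<open>\<omega>\<close> are tested, so a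
  loss of arbitrarily small powers of \<open>t\<close> does no harm. A finite limsup would bound the
  function near infinity, which \<open>low\<close> excludes.\<close>

lemma weak_uniform_exponent_eqI:
  fixes L :: "(real ^ 'n) set"
  assumes up: "\<And>\<gamma>. \<gamma> < \<omega> \<Longrightarrow> \<exists>M. eventually (\<lambda>t. t powr \<gamma> * lattice_psi L t \<le> M) at_top"
    and low: "\<And>\<gamma> M K. \<omega> < \<gamma> \<Longrightarrow> \<exists>t\<ge>K. M < t powr \<gamma> * lattice_psi L t"
  shows "weak_uniform_exponent L = ereal \<omega>"
proof (rule antisym)
  show "weak_uniform_exponent L \<le> ereal \<omega>"
    unfolding weak_uniform_exponent_def
  proof (rule Sup_least, rule ccontr)
    fix g assume "g \<in> {ereal \<gamma> | \<gamma>. Limsup at_top (\<lambda>t. ereal (t powr \<gamma> * lattice_psi L t)) < \<infinity>}"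
      and "\<not> g \<le> ereal \<omega>"
    then obtain \<gamma> where lim: "Limsup at_top (\<lambda>t. ereal (t powr \<gamma> * lattice_psi L t)) < \<infinity>"
      and "\<not> \<gamma> \<le> \<omega>" by auto
    from lim obtain M where "Limsup at_top (\<lambda>t. ereal (t powr \<gamma> * lattice_psi L t)) < ereal M"
      using less_PInf_Ex_of_nat by auto
    then have "eventually (\<lambda>t. ereal (t powr \<gamma> * lattice_psi L t) < ereal M) at_top"
      by (rule Limsup_lessD)
    then obtain K where "\<And>t. t \<ge> K \<Longrightarrow> t powr \<gamma> * lattice_psi L t < M"
      by (auto simp: eventually_at_top_linorder)
    moreover obtain t where "t \<ge> K" "M < t powr \<gamma> * lattice_psi L t"
      using low[of \<gamma> K M] \<open>\<not> \<gamma> \<le> \<omega>\<close> by auto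
    ultimately show False by fastforce
  qed
  show "ereal \<omega> \<le> weak_uniform_exponent L"
  proof (rule ccontr)
    assume "\<not> ?thesis"
    then obtain \<gamma> where \<gamma>: "weak_uniform_exponent L < ereal \<gamma>" "\<gamma> < \<omega>"
      by (metis ereal_dense2 ereal_less_eq(3) less_ereal.simps(1) not_le)
    obtain M where "eventually (\<lambda>t. t powr \<gamma> * lattice_psi L t \<le> M) at_top" using up[OF \<gamma>(2)] by blast
    then have "Limsup at_top (\<lambda>t. ereal (t powr \<gamma> * lattice_psi L t)) \<le> ereal M"
      by (intro Limsup_bounded) simp
    then have "Limsup at_top (\<lambda>t. ereal (t powr \<gamma> * lattice_psi L t)) < \<infinity>"
      by (rule le_less_trans) simp
    then have "ereal \<gamma> \<le> weak_uniform_exponent L"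
      unfolding weak_uniform_exponent_def by (intro Sup_upper) blast
    with \<gamma>(1) show False by simp
  qed
qed

text \<open>In dimension at least 2 a standard basis vector has a vanishing coordinate, so the
  minimum is eventually 0 and every exponent is admissible.\<close>

lemma weak_uniform_exponent_integer_points:
  assumes "CARD('n::finite) \<ge> 2"
  shows "weak_uniform_exponent {x :: real ^ 'n. \<forall>i. x $ i \<in> \<int>} = \<infinity>"
proof -
  let ?L = "{x :: real ^ 'n. \<forall>i. x $ i \<in> \<int>}"
  obtain i j :: 'n where "i \<noteq> j"
    using assms by (metis (full_types) UNIV_I card_2_iff' card_le_Suc0_iff_eq finite not_less_eq_eq numeral_2_eq_2)
  let ?x = "axis i 1 :: real ^ 'n"
  have x: "?x \<in> ?L" "?x \<noteq> 0" by (auto simp: axis_def vec_eq_iff)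
  have "?x $ j = 0" using \<open>i \<noteq> j\<close> by (simp add: axis_def)
  then have "(\<Prod>i\<in>UNIV. ?x $ i) = 0" by (intro prod_zero) auto
  then have gx: "geo_prod ?x = 0" by (simp add: geo_prod_eq)
  have "lattice_psi ?L t = 0" if "t \<ge> infnorm ?x" for t
    using lattice_psi_le[OF full_rank_lattice_integer_points x that] gx
      lattice_psi_ge[OF full_rank_lattice_integer_points x that, of 0] geo_prod_nonneg
    by fastforce
  then have "eventually (\<lambda>t. ereal (t powr \<gamma> * lattice_psi ?L t) \<le> 0) at_top" for \<gamma>
    by (intro eventually_at_top_linorderI[of "infnorm ?x"]) simp
  then have "Limsup at_top (\<lambda>t. ereal (t powr \<gamma> * lattice_psi ?L t)) \<le> 0" for \<gamma>
    by (rule Limsup_bounded)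
  then have "Limsup at_top (\<lambda>t. ereal (t powr \<gamma> * lattice_psi ?L t)) < \<infinity>" for \<gamma>
    by (rule le_less_trans) simp
  then have "ereal \<gamma> \<le> weak_uniform_exponent ?L" for \<gamma>
    unfolding weak_uniform_exponent_def by (intro Sup_upper) blast
  then show ?thesis by (intro ereal_top) 
qed

section \<open>Norm-form lattices\<close>

definition ipoly :: "int poly \<Rightarrow> real \<Rightarrow> real" where
  "ipoly p x = poly (map_poly of_int p) x"

lemma ipoly_pCons [simp]: "ipoly (pCons a p) x = of_int a + x * ipoly p x"
  by (simp add: ipoly_def map_poly_pCons)

lemma ipoly_0 [simp]: "ipoly 0 x = 0"
  by (simp add: ipoly_def)

lemma ipoly_1 [simp]: "ipoly 1 x = 1"
  by (simp add: ipoly_def)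

lemma ipoly_add [simp]: "ipoly (p + q) x = ipoly p x + ipoly q x"
proof -
  have "map_poly of_int (p + q) = map_poly of_int p + (map_poly of_int q :: real poly)"
    by (intro poly_eqI) (simp add: coeff_map_poly)
  then show ?thesis by (simp add: ipoly_def)
qed

lemma ipoly_diff [simp]: "ipoly (p - q) x = ipoly p x - ipoly q x"
  using ipoly_add[of "p - q" q x] by simp

lemma ipoly_smult [simp]: "ipoly (smult c p) x = of_int c * ipoly p x"
  by (induction p) (simp_all add: algebra_simps)

lemma ipoly_mult [simp]: "ipoly (p * q) x = ipoly p x * ipoly q x"
  by (induction p) (simp_all add: algebra_simps)

lemma ipoly_monom [simp]: "ipoly (monom c n) x = of_int c * x ^ n"
  by (simp add: ipoly_def map_poly_monom poly_monom)

lemma ipoly_sum: "ipoly (\<Sum>i\<in>I. p i) x = (\<Sum>i\<in>I. ipoly (p i) x)"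
  by (induction I rule: infinite_finite_induct) simp_all

lemma ipoly_prod: "ipoly (\<Prod>i\<in>I. p i) x = (\<Prod>i\<in>I. ipoly (p i) x)"
  by (induction I rule: infinite_finite_induct) simp_all

text \<open>The bijection \<open>e\<close> indexes the powers of \<open>x\<close> by a finite type,
  which turns evaluation into the product of a coefficient row with a Vandermonde column. The
  disjunction is the form in which pseudo-division bounds its remainder.\<close>

lemma ipoly_eq_sum_coeff:
  assumes "bij_betw e UNIV {..<n}" "p = 0 \<or> degree p < n"
  shows "ipoly p x = (\<Sum>j\<in>UNIV. of_int (coeff p (e j)) * x ^ e j)"
proof -
  have "ipoly p x = (\<Sum>k\<le>degree p. of_int (coeff p k) * x ^ k)"
    by (simp add: ipoly_def poly_altdef coeff_map_poly degree_map_poly)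
  also have "\<dots> = (\<Sum>k<n. of_int (coeff p k) * x ^ k)"
  proof (cases "n = 0")
    case False
    then show ?thesis using assms(2)
      by (intro sum.mono_neutral_left) (auto simp: coeff_eq_0)
  qed (use assms(2) in auto)
  also have "\<dots> = (\<Sum>j\<in>UNIV. of_int (coeff p (e j)) * x ^ e j)"
    by (rule sum.reindex_bij_betw[OF assms(1), symmetric])
  finally show ?thesis .
qed

text \<open>A factorisation \<open>g * h\<close> takes the value \<open>-1\<close> at every \<open>a i\<close>, so \<open>g + h\<close> vanishes there; if both
  factors had smaller degree, \<open>h = - g\<close> would contradict the leading coefficient.\<close>

lemma irreducible_prod_linear_minus_one:
  fixes a :: "'n \<Rightarrow> int"
  assumes "finite I" "I \<noteq> {}" "inj_on a I"
  shows "irreducible ((\<Prod>i\<in>I. [:- a i, 1:]) - 1)"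
proof -
  define P where "P = (\<Prod>i\<in>I. [:- a i, 1:])"
  have degP: "degree P = card I" unfolding P_def
    by (subst degree_prod_eq_sum_degree) auto
  have lcP: "lead_coeff P = 1" unfolding P_def by (simp add: lead_coeff_prod)
  have cardI: "card I > 0" using assms by (simp add: card_gt_0_iff)
  define f where "f = P - 1"
  have degf: "degree f = card I" unfolding f_def
    using degP cardI degree_add_eq_left[of "- 1" P] by simp
  have lcf: "lead_coeff f = 1" using lcP degP degf cardI unfolding f_def by (simp add: coeff_1)
  have fa: "poly f (a i) = -1" if "i \<in> I" for i
    using that assms(1) by (auto simp: f_def P_def poly_prod)
  have "irreducible f"
  proof (rule irreducibleI)
    show "f \<noteq> 0" using lcf by auto
    show "\<not> is_unit f" using degf cardI by (auto simp: is_unit_poly_iff)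
    fix g h assume fgh: "f = g * h"
    have g0: "g \<noteq> 0" and h0: "h \<noteq> 0" using fgh lcf by auto
    have lc: "lead_coeff g * lead_coeff h = 1" using lcf fgh by (simp add: lead_coeff_mult)
    have deg: "degree g + degree h = card I" using degf fgh g0 h0 by (simp add: degree_mult_eq)
    have const: "is_unit p" if "degree p = 0" "lead_coeff p dvd 1" for p :: "int poly"
      using that by (auto elim!: degree_eq_zeroE simp: is_unit_const_poly_iff)
    have "degree g = 0 \<or> degree h = 0"
    proof (rule ccontr)
      assume "\<not> ?thesis"
      then have lt: "degree g < card I" "degree h < card I" using deg by auto
      have z: "poly (g + h) (a i) = 0" if "i \<in> I" for i
      proof -
        have "poly g (a i) * poly h (a i) = -1" using fa[OF that] fgh by simp
        then have "(poly g (a i) = 1 \<and> poly h (a i) = -1) \<or> (poly g (a i) = -1 \<and> poly h (a i) = 1)"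
          using zmult_eq_1_iff[of "poly g (a i)" "- poly h (a i)"] by auto
        then show ?thesis by auto
      qed
      have "g + h = 0"
      proof (rule ccontr)
        assume nz: "g + h \<noteq> 0"
        have "card (a ` I) \<le> card {x. poly (g + h) x = 0}"
          using z by (intro card_mono poly_roots_finite nz) auto
        also have "\<dots> \<le> degree (g + h)" by (rule card_poly_roots_bound[OF nz])
        also have "\<dots> < card I" using lt by (meson degree_add_less)
        finally show False using card_image[OF assms(3)] by simp
      qed
      then have "h = - g" by (simp add: add_eq_0_iff)
      then have "- (lead_coeff g * lead_coeff g) = 1" using lc by simp
      moreover have "lead_coeff g * lead_coeff g \<ge> 0" by simp
      ultimately show False by linarith
    qed
    then show "is_unit g \<or> is_unit h"
      using const lc by (metis dvd_triv_left dvd_triv_right)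
  qed
  then show ?thesis unfolding f_def P_def .
qed

text \<open>Let \<open>P\<close> be of least degree among the nonzero polynomials vanishing at
  \<open>\<theta>\<close>, supposing this degree is below that of \<open>f\<close>. The
  pseudo-remainder of \<open>f\<close> by \<open>P\<close> vanishes at \<open>\<theta>\<close>,
  hence is 0, and a multiple \<open>smult c f\<close> equals \<open>P * q\<close>. As
  \<open>f\<close> is prime in the factorial ring of integer polynomials, it divides
  \<open>P\<close> or \<open>q\<close>; the first contradicts degrees, the second makes
  \<open>P\<close> a nonzero constant.\<close>

lemma irreducible_int_poly_root_degree:
  fixes f p :: "int poly" and \<theta> :: real
  assumes irr: "irreducible f" and root: "ipoly f \<theta> = 0"
    and p: "p \<noteq> 0" "ipoly p \<theta> = 0"
  shows "degree f \<le> degree p"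
proof (rule ccontr)
  assume "\<not> ?thesis"
  then have ex: "\<exists>p. p \<noteq> 0 \<and> ipoly p \<theta> = 0 \<and> degree p < degree f" using p by auto
  define P where "P = arg_min degree (\<lambda>p. p \<noteq> 0 \<and> ipoly p \<theta> = 0 \<and> degree p < degree f)"
  have P: "P \<noteq> 0" "ipoly P \<theta> = 0" "degree P < degree f"
    using arg_min_natI[of "\<lambda>p. p \<noteq> 0 \<and> ipoly p \<theta> = 0 \<and> degree p < degree f"] ex
    unfolding P_def by blast+
  have min: "degree P \<le> degree q" if "q \<noteq> 0" "ipoly q \<theta> = 0" "degree q < degree f" for q
    unfolding P_def by (rule arg_min_nat_le) (use that in auto)
  obtain c q where cq: "c \<noteq> 0" "smult c f = P * q + pseudo_mod f P" using pseudo_mod(1)[OF P(1)] by blast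
  have r: "pseudo_mod f P = 0 \<or> degree (pseudo_mod f P) < degree P" by (rule pseudo_mod(2)[OF P(1)])
  have "ipoly (pseudo_mod f P) \<theta> = ipoly (smult c f - P * q) \<theta>"
    using cq(2) by simp
  also have "\<dots> = 0" using root P(2) by simp
  finally have "pseudo_mod f P = 0"
    using r min[of "pseudo_mod f P"] P(3) by (meson leD less_trans)
  then have eq: "smult c f = P * q" using cq by simp
  have "f dvd P * q" unfolding eq[symmetric] by (rule dvd_smult) simp
  moreover have "prime_elem f" using irr by (simp add: prime_elem_iff_irreducible)
  ultimately have "f dvd P \<or> f dvd q" by (rule prime_elem_dvd_multD[rotated])
  moreover have "\<not> f dvd P" using P(3) dvd_imp_degree_le[OF _ P(1), of f] by auto
  moreover have "\<not> f dvd q"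
  proof
    assume "f dvd q"
    moreover have "q \<noteq> 0" using eq cq irr by auto
    ultimately have "degree f \<le> degree q" by (rule dvd_imp_degree_le)
    moreover have "degree f = degree P + degree q"
      using eq cq(1) P(1) \<open>q \<noteq> 0\<close> by (metis degree_mult_eq degree_smult_eq)
    ultimately have "degree P = 0" by simp
    then obtain a where "P = [:a:]" by (rule degree_eq_zeroE)
    then show False using P by simp
  qed
  ultimately show False by blast
qed

text \<open>The nodes are 4 apart, so within distance 1 of the node \<open>a\<close> all other
  factors have absolute value at least 3, and their product \<open>R\<close> keeps its sign. The
  full product is 0 at \<open>a\<close> and at least 3 at one of \<open>a + 1\<close>,
  \<open>a - 1\<close>, according to that sign; it takes the value 1 in between.\<close>

lemma prod_linear_minus_one_root:
  fixes e :: "'n \<Rightarrow> nat"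
  assumes "finite I" "inj_on e I" "i \<in> I" "card I \<ge> 2"
  shows "\<exists>\<theta>::real. \<bar>\<theta> - 4 * real (e i)\<bar> < 1 \<and> (\<Prod>j\<in>I. (\<theta> - 4 * real (e j))) = 1"
proof -
  define a where "a = 4 * real (e i)"
  define p where "p = (\<lambda>x::real. \<Prod>j\<in>I. (x - 4 * real (e j)))"
  define R where "R = (\<lambda>x::real. \<Prod>j\<in>I - {i}. (x - 4 * real (e j)))"
  have split: "p x = (x - a) * R x" for x
    unfolding p_def R_def a_def using assms by (subst prod.remove[of I i]) auto
  have cont: "continuous_on A p" "continuous_on A R" for A
    unfolding p_def R_def by (intro continuous_intros)+
  have far: "\<bar>x - 4 * real (e j)\<bar> \<ge> 3" if "\<bar>x - a\<bar> \<le> 1" "j \<in> I - {i}" for x j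
  proof -
    have "e j \<noteq> e i" using that assms by (auto dest: inj_onD)
    then have "\<bar>real (e j) - real (e i)\<bar> \<ge> 1" by linarith
    then show ?thesis using that(1) unfolding a_def by linarith
  qed
  have bigR: "\<bar>R x\<bar> \<ge> 3" if "\<bar>x - a\<bar> \<le> 1" for x
  proof -
    \<comment> \<open>There is at least one other factor because \<open>I\<close> has two
      elements.\<close>
    have "(3::real) ^ 1 \<le> 3 ^ card (I - {i})"
      using assms by (intro power_increasing) auto
    also have "\<dots> = (\<Prod>j\<in>I - {i}. 3)" by simp
    also have "\<dots> \<le> (\<Prod>j\<in>I - {i}. \<bar>x - 4 * real (e j)\<bar>)"
      by (intro prod_mono) (use far[OF that] in auto)
    also have "\<dots> = \<bar>R x\<bar>" unfolding R_def abs_prod ..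
    finally show ?thesis by simp
  qed
  obtain \<theta> where \<theta>: "a - 1 \<le> \<theta>" "\<theta> \<le> a + 1" "p \<theta> = 1"
  proof (cases "R a > 0")
    case True
    have "R (a + 1) > 0"
    proof (rule ccontr)
      assume "\<not> ?thesis"
      then obtain y where "a \<le> y" "y \<le> a + 1" "R y = 0"
        using IVT2'[of R "a + 1" 0 a] True cont(2) by auto
      then show False using bigR[of y] by simp
    qed
    then have "p (a + 1) \<ge> 3" using bigR[of "a + 1"] split[of "a + 1"] by simp
    then obtain x where "a \<le> x" "x \<le> a + 1" "p x = 1"
      using IVT'[of p a 1 "a + 1"] split[of a] cont(1) by auto
    then show ?thesis using that[of x] by simp
  next
    case False
    have neg: "R a < 0" using False bigR[of a] by simp
    have "R (a - 1) < 0"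
    proof (rule ccontr)
      assume "\<not> ?thesis"
      then obtain y where "a - 1 \<le> y" "y \<le> a" "R y = 0"
        using IVT2'[of R a 0 "a - 1"] neg cont(2) by auto
      then show False using bigR[of y] by simp
    qed
    then have "p (a - 1) \<ge> 3" using bigR[of "a - 1"] split[of "a - 1"] by simp
    then obtain x where "a - 1 \<le> x" "x \<le> a" "p x = 1"
      using IVT2'[of p a 1 "a - 1"] split[of a] cont(1) by auto
    then show ?thesis using that[of x] by simp
  qed
  \<comment> \<open>At either end point the product has absolute value at least 3.\<close>
  have "\<theta> \<noteq> a + 1" "\<theta> \<noteq> a - 1"
    using \<theta>(3) split[of \<theta>] bigR[of \<theta>] by auto
  then have "\<bar>\<theta> - a\<bar> < 1" using \<theta>(1,2) by auto
  then show ?thesis using \<theta>(3) unfolding a_def p_def by blast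
qed

text \<open>The lattice consists of the vectors of values \<open>P(\<theta> i)\<close>, where
  \<open>P\<close> runs through the integer polynomials of degree below d and the
  \<open>\<theta> i\<close> are the d real roots of an irreducible monic \<open>f\<close>. The
  product of the coordinates is the norm of the algebraic integer \<open>P(\<theta>)\<close>, a
  nonzero integer when \<open>P\<close> is nonzero.\<close>

lemma ex_norm_lattice:
  assumes card: "CARD('n::finite) \<ge> 2"
  obtains L :: "(real ^ 'n) set" where "full_rank_lattice L"
    "\<And>x. x \<in> L \<Longrightarrow> x \<noteq> 0 \<Longrightarrow> 1 \<le> \<bar>\<Prod>i\<in>UNIV. x $ i\<bar>"
proof -
  let ?d = "CARD('n)"
  obtain e :: "'n \<Rightarrow> nat" where e: "bij_betw e UNIV {..<?d}"
    using ex_bij_betw_finite_nat[of "UNIV :: 'n set"] by (auto simp: atLeast0LessThan)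
  have inje: "inj e" using e by (simp add: bij_betw_def)
  \<comment> \<open>Nodes spaced by 4 give one real root within distance 1 of each node, hence d
    distinct real roots: the number field is totally real.\<close>
  define f :: "int poly" where "f = (\<Prod>i\<in>UNIV. [:- (4 * int (e i)), 1:]) - 1"
  have irr: "irreducible f" unfolding f_def
    by (rule irreducible_prod_linear_minus_one) (use inje in \<open>auto simp: inj_on_def\<close>)
  have degP: "degree (\<Prod>i\<in>UNIV. [:- (4 * int (e i)), 1:]) = ?d"
    by (subst degree_prod_eq_sum_degree) auto
  have lcP: "lead_coeff (\<Prod>i\<in>UNIV. [:- (4 * int (e i)), 1:]) = 1" by (simp add: lead_coeff_prod)
  have degf: "degree f = ?d" unfolding f_def
    using degP degree_add_eq_left[of "- 1" "\<Prod>i\<in>UNIV. [:- (4 * int (e i)), 1:]"] by simp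
  have lcf: "lead_coeff f = 1" using lcP degP degf unfolding f_def by (simp add: coeff_1)
  have "\<forall>i. \<exists>\<theta>::real. \<bar>\<theta> - 4 * real (e i)\<bar> < 1 \<and> (\<Prod>j\<in>UNIV. (\<theta> - 4 * real (e j))) = 1"
    using prod_linear_minus_one_root[of "UNIV :: 'n set" e] inje card by simp
  then obtain \<theta> where \<theta>: "\<And>i. \<bar>\<theta> i - 4 * real (e i)\<bar> < 1"
    "\<And>i. (\<Prod>j\<in>UNIV. (\<theta> i - 4 * real (e j))) = 1" by metis
  have root: "ipoly f (\<theta> i) = 0" for i
    using \<theta>(2)[of i] by (simp add: f_def ipoly_prod)
  have inj\<theta>: "inj \<theta>"
  proof (rule injI)
    fix i j assume "\<theta> i = \<theta> j"
    then have "\<bar>4 * real (e i) - 4 * real (e j)\<bar> < 2" using \<theta>(1)[of i] \<theta>(1)[of j] by linarith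
    then have "e i = e j" by linarith
    then show "i = j" using inje by (simp add: inj_eq)
  qed
  \<comment> \<open>The Vandermonde matrix of the roots; \<open>g\<close> sends a coefficient vector
    to the values of its polynomial, and is injective because a nonzero polynomial of degree below d
    cannot have d roots.\<close>
  define V :: "real ^ 'n ^ 'n" where "V = (\<chi> j i. \<theta> i ^ e j)"
  define g :: "real ^ 'n \<Rightarrow> real ^ 'n" where "g = (\<lambda>x. x v* V)"
  have g_nth: "g x $ i = (\<Sum>j\<in>UNIV. x $ j * \<theta> i ^ e j)" for x i
    unfolding g_def V_def by (simp add: vector_matrix_mult_def mult.commute)
  have ling: "linear g" unfolding g_def
    by (rule linearI) (simp_all add: vector_matrix_left_distrib scaleR_vector_matrix_assoc)
  have injg: "inj g"
  proof (subst linear_injective_0[OF ling], intro allI impI)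
    fix x assume gx: "g x = 0"
    define p where "p = (\<Sum>j\<in>UNIV. monom (x $ j) (e j))"
    have pcoeff: "coeff p (e j) = x $ j" for j
    proof -
      have "coeff p (e j) = (\<Sum>k\<in>UNIV. if k = j then x $ k else 0)"
        unfolding p_def coeff_sum by (intro sum.cong) (auto simp: inje inj_eq)
      then show ?thesis by simp
    qed
    have "p = 0"
    proof (rule ccontr)
      assume nz: "p \<noteq> 0"
      have "poly p (\<theta> i) = 0" for i
        using gx g_nth[of x i] by (simp add: p_def poly_sum poly_monom)
      then have "card (range \<theta>) \<le> card {x. poly p x = 0}"
        by (intro card_mono poly_roots_finite nz) auto
      also have "\<dots> \<le> degree p" by (rule card_poly_roots_bound[OF nz])
      also have "\<dots> \<le> ?d - 1" unfolding p_def
      proof (intro degree_sum_le)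
        fix j :: 'n
        have "e j < ?d" using e by (auto simp: bij_betw_def)
        then show "degree (monom (x $ j) (e j)) \<le> ?d - 1"
          using degree_monom_le[of "x $ j" "e j"] by linarith
      qed auto
      finally show False using card_image[OF inj\<theta>] card by simp
    qed
    then show "x = 0" using pcoeff by (simp add: vec_eq_iff)
  qed
  have detV: "det V \<noteq> 0"
  proof -
    have "inj ((*v) (transpose V))" using injg unfolding g_def by (simp add: inj_def)
    then have "invertible (transpose V)"
      by (simp add: matrix_left_invertible_injective invertible_left_inverse inj_def)
    then show ?thesis by (simp add: invertible_det_nz)
  qed
  let ?Z = "{x :: real ^ 'n. \<forall>i. x $ i \<in> \<int>}"
  have "full_rank_lattice (g ` ?Z)"
    by (rule full_rank_lattice_image[OF full_rank_lattice_integer_points ling injg])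
  moreover have "1 \<le> \<bar>\<Prod>i\<in>UNIV. y $ i\<bar>" if y: "y \<in> g ` ?Z" "y \<noteq> 0" for y
  proof -
    obtain x where x: "\<And>i. x $ i \<in> \<int>" "y = g x" using y(1) by blast
    have "\<forall>i. \<exists>m. x $ i = of_int m" using x(1) by (auto elim!: Ints_cases)
    then obtain m where m: "\<And>i. x $ i = of_int (m i)" by metis
    define P :: "int poly" where "P = (\<Sum>j\<in>UNIV. monom (m j) (e j))"
    have Py: "ipoly P (\<theta> i) = y $ i" for i
      by (simp add: P_def ipoly_sum x(2) g_nth m)
    have "P \<noteq> 0" using Py y(2) by (auto simp: vec_eq_iff)
    have degP: "degree P < ?d" unfolding P_def
    proof (rule le_less_trans[OF degree_sum_le[of _ _ "?d - 1"]])
      fix j :: 'n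
      have "e j < ?d" using e by (auto simp: bij_betw_def)
      then show "degree (monom (m j) (e j)) \<le> ?d - 1"
        using degree_monom_le[of "m j" "e j"] by linarith
    qed (use card in auto)
    \<comment> \<open>A zero coordinate would make \<open>P\<close>, of smaller degree than
      \<open>f\<close>, vanish at a root of \<open>f\<close>.\<close>
    have y0: "y $ i \<noteq> 0" for i
      using irreducible_int_poly_root_degree[OF irr root \<open>P \<noteq> 0\<close>, of i] Py degP degf by auto
    define q where "q = (\<lambda>k. pseudo_mod (monom 1 (e k) * P) f)"
    have f0: "f \<noteq> 0" using lcf by auto
    have q_root: "ipoly (q k) (\<theta> i) = \<theta> i ^ e k * y $ i" for k i
    proof -
      obtain h r where hr: "pseudo_divmod (monom 1 (e k) * P) f = (h, r)" by force
      have "monom 1 (e k) * P = f * h + r" using pseudo_divmod(1)[OF f0 hr] lcf by simp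
      moreover have "q k = r" unfolding q_def pseudo_mod_def using hr by simp
      ultimately have "ipoly (monom 1 (e k) * P) (\<theta> i) = ipoly (f * h + q k) (\<theta> i)" by simp
      then show ?thesis by (simp add: root Py)
    qed
    have q_deg: "q k = 0 \<or> degree (q k) < ?d" for k
      unfolding q_def using pseudo_mod(2)[OF f0] degf by metis
    \<comment> \<open>\<open>A\<close> is the integer matrix of multiplication by \<open>P\<close> modulo \<open>f\<close>; its determinant is the norm of \<open>P\<close>.\<close>
    define A :: "real ^ 'n ^ 'n" where "A = (\<chi> k j. of_int (coeff (q k) (e j)))"
    define D :: "real ^ 'n ^ 'n" where "D = (\<chi> i j. if i = j then y $ i else 0)"
    \<comment> \<open>The i-th column of \<open>V\<close> is an eigenvector of \<open>A\<close> with
      eigenvalue \<open>y $ i\<close>.\<close>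
    have "A ** V = V ** D"
      unfolding A_def V_def D_def matrix_matrix_mult_def
      using q_root by (simp add: vec_eq_iff ipoly_eq_sum_coeff[OF e q_deg] if_distrib cong: if_cong)
    then have "det A * det V = det V * det D" by (metis det_mul)
    then have "det A = det D" using detV by simp
    also have "\<dots> = (\<Prod>i\<in>UNIV. y $ i)" by (subst det_diagonal) (auto simp: D_def)
    finally have "(\<Prod>i\<in>UNIV. y $ i) = det A" ..
    moreover have "det A \<in> \<int>" unfolding det_def A_def
      by (intro Ints_sum Ints_mult Ints_prod) auto
    moreover have "(\<Prod>i\<in>UNIV. y $ i) \<noteq> 0" using y0 by simp
    ultimately show ?thesis by (metis Ints_nonzero_abs_ge1)
  qed
  ultimately show ?thesis using that by blast
qed

section \<open>Ratios of coordinates of lattice points\<close>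

text \<open>The d-th power of \<open>geo_prod\<close>; on the lattice of conjugate vectors it is the
  absolute value of the field norm.\<close>

definition abs_prod_coords :: "real ^ 'n \<Rightarrow> real" where
  "abs_prod_coords x = \<bar>\<Prod>k\<in>UNIV. x $ k\<bar>"

lemma abs_prod_coords_eq: "abs_prod_coords x = (\<Prod>k\<in>UNIV. \<bar>x $ k\<bar>)"
  by (simp add: abs_prod_coords_def abs_prod)

lemma abs_prod_coords_le_power:
  fixes x :: "real ^ 'n"
  assumes "infnorm x \<le> T"
  shows "abs_prod_coords x \<le> T ^ CARD('n)"
proof -
  have "abs_prod_coords x \<le> (\<Prod>k\<in>(UNIV :: 'n set). T)"
    unfolding abs_prod_coords_eq
    by (intro prod_mono) (use assms component_le_infnorm_cart[of x] order.trans in auto)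
  then show ?thesis by simp
qed

lemma infnorm_le_iff_cart: "infnorm (x :: real ^ 'n) \<le> r \<longleftrightarrow> (\<forall>k. \<bar>x $ k\<bar> \<le> r)"
proof
  assume "infnorm x \<le> r"
  then show "\<forall>k. \<bar>x $ k\<bar> \<le> r" using component_le_infnorm_cart order.trans by blast
next
  assume "\<forall>k. \<bar>x $ k\<bar> \<le> r"
  then show "infnorm x \<le> r" unfolding infnorm_cart by (intro cSup_least) auto
qed

text \<open>Thickens a slope with an open property to a closed interval of such slopes, the shape
  needed for nested intervals.\<close>

lemma interval_around:
  fixes z :: real
  assumes "open A" "z \<in> A" "p < z" "z < q"
  obtains a b where "p \<le> a" "a < z" "z < b" "b \<le> q" "{a..b} \<subseteq> A"
proof -
  have "open (A \<inter> {p<..<q})" "z \<in> A \<inter> {p<..<q}" using assms by auto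
  then obtain e where e: "e > 0" "cball z e \<subseteq> A \<inter> {p<..<q}" using open_contains_cball_eq by blast
  then have sub: "{z - e..z + e} \<subseteq> A \<inter> {p<..<q}" by (simp add: cball_eq_atLeastAtMost)
  then have "z - e \<in> {p<..<q}" "z + e \<in> {p<..<q}" using e(1) by (auto simp: subset_iff)
  then show ?thesis using e(1) sub by (intro that[of "z - e" "z + e"]) auto
qed

lemma eventually_powr_small:
  fixes C e \<alpha> :: real
  assumes "\<alpha> < 0" "e > 0"
  shows "eventually (\<lambda>T. C * T powr \<alpha> < e) at_top"
proof -
  have "((\<lambda>T. T powr \<alpha>) \<longlongrightarrow> 0) at_top"
    using tendsto_neg_powr[OF assms(1) filterlim_ident] .
  then have "((\<lambda>T. C * T powr \<alpha>) \<longlongrightarrow> C * 0) at_top" by (intro tendsto_intros)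
  then show ?thesis using assms(2) by (intro order_tendstoD(2)) auto
qed

text \<open>A value reached for time \<open>T\<close> is still small enough at time
  \<open>T powr (1 + \<delta>)\<close>, at the price of dividing the exponent by
  \<open>1 + \<delta>\<close>; this bridges the gap until the next good point becomes
  available.\<close>

lemma powr_cover:
  fixes t T \<nu> \<delta> :: real
  assumes "1 \<le> t" "1 \<le> T" "t \<le> T powr (1 + \<delta>)" "\<nu> \<ge> 0" "\<delta> > 0"
  shows "T powr - \<nu> \<le> t powr (- \<nu> / (1 + \<delta>))"
proof -
  have "(T powr (1 + \<delta>)) powr (- \<nu> / (1 + \<delta>)) \<le> t powr (- \<nu> / (1 + \<delta>))"
    using assms by (intro powr_mono2') (auto simp: divide_nonpos_pos)
  then show ?thesis using assms by (simp add: powr_powr)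
qed

text \<open>The coordinates \<open>i\<close> and \<open>j\<close> are the ones that the shear
  mixes.\<close>

locale norm_lattice =
  fixes L :: "(real ^ 'n) set" and i j :: 'n
  assumes lattice: "full_rank_lattice L"
    and norm_ge_1: "\<And>x. x \<in> L \<Longrightarrow> x \<noteq> 0 \<Longrightarrow> 1 \<le> abs_prod_coords x"
    and ij: "i \<noteq> j"
begin

definition pts :: "real \<Rightarrow> (real ^ 'n) set" where
  "pts T = {x \<in> L. x \<noteq> 0 \<and> infnorm x \<le> T}"

lemma finite_pts: "finite (pts T)"
  unfolding pts_def by (rule finite_subset[OF _ full_rank_lattice_finite[OF lattice, of T]]) auto

lemma coord_nonzero: "x \<in> L \<Longrightarrow> x \<noteq> 0 \<Longrightarrow> x $ k \<noteq> 0"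
proof
  assume x: "x \<in> L" "x \<noteq> 0" and "x $ k = 0"
  then have "(\<Prod>k\<in>UNIV. x $ k) = 0" by (intro prod_zero) auto
  then show False using norm_ge_1[OF x] unfolding abs_prod_coords_def by linarith
qed

text \<open>If a box of volume \<open>V\<close> is cut along one coordinate into more than \<open>V\<close> slices, two lattice points in
  the same slice would have a difference of norm less than 1.\<close>

lemma sum_inverse_norm_dyadic_box:
  fixes K :: "'n \<Rightarrow> int" and sg :: "'n \<Rightarrow> bool"
  assumes fin: "finite F" and F: "F \<subseteq> L - {0}"
    and box: "\<And>x k. x \<in> F \<Longrightarrow> \<lfloor>log 2 \<bar>x $ k\<bar>\<rfloor> = K k \<and> (x $ k > 0) = sg k"
  shows "(\<Sum>x\<in>F. 1 / abs_prod_coords x) \<le> 1 + 2 ^ CARD('n)"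
proof (cases "F = {}")
  case False
  \<comment> \<open>\<open>c k\<close> is the smallest size of the k-th coordinate in the dyadic
    box, and also its side length; \<open>V\<close> is the volume.\<close>
  define c where "c = (\<lambda>k. 2 powr real_of_int (K k))"
  define V where "V = (\<Prod>k\<in>UNIV. c k)"
  have c0: "c k > 0" for k by (simp add: c_def)
  have V0: "V > 0" unfolding V_def by (intro prod_pos) (use c0 in auto)
  have x0: "x $ k \<noteq> 0" if "x \<in> F" for x k using F that coord_nonzero by blast
  have cx: "c k \<le> \<bar>x $ k\<bar>" "\<bar>x $ k\<bar> < 2 * c k" if "x \<in> F" for x k
  proof -
    have "real_of_int (K k) \<le> log 2 \<bar>x $ k\<bar>" "log 2 \<bar>x $ k\<bar> < real_of_int (K k) + 1"
      using box[OF that, of k] by linarith+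
    then show "c k \<le> \<bar>x $ k\<bar>" "\<bar>x $ k\<bar> < 2 * c k"
      using x0[OF that, of k] by (auto simp: c_def le_log_iff log_less_iff powr_add)
  qed
  have V_le: "V \<le> abs_prod_coords x" if "x \<in> F" for x
    unfolding V_def abs_prod_coords_eq by (intro prod_mono) (use cx[OF that] c0 in \<open>auto intro: less_imp_le\<close>)
  obtain x where x: "x \<in> F" using False by blast
  \<comment> \<open>A single point of norm at least 1 prevents the volume from being small.\<close>
  have "1 \<le> abs_prod_coords x" using x F norm_ge_1 by blast
  also have "\<dots> \<le> (\<Prod>k\<in>UNIV. 2 * c k)"
    unfolding abs_prod_coords_eq by (intro prod_mono) (use cx[OF x] in \<open>auto intro: less_imp_le\<close>)
  also have "\<dots> = 2 ^ CARD('n) * V" by (simp add: V_def prod.distrib)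
  finally have V_ge: "1 / V \<le> 2 ^ CARD('n)" using V0 by (simp add: field_simps)
  define m where "m = nat \<lfloor>V\<rfloor> + 1"
  have mV: "V < real m" "real m \<le> V + 1" unfolding m_def using V0 by linarith+
  have m0: "real m > 0" by (simp add: m_def)
  define q where "q = (\<lambda>x :: real ^ 'n. \<lfloor>real m * \<bar>x $ i\<bar> / c i\<rfloor>)"
  have "inj_on q F"
  proof (rule inj_onI, rule ccontr)
    fix x y assume xy: "x \<in> F" "y \<in> F" "q x = q y" "x \<noteq> y"
    \<comment> \<open>Coordinates of the two points have equal signs, so the difference stays below
      the side length.\<close>
    have abs_diff: "\<bar>(x - y) $ k\<bar> = \<bar>\<bar>x $ k\<bar> - \<bar>y $ k\<bar>\<bar>" for k
      using box[OF xy(1), of k] box[OF xy(2), of k] by (cases "sg k") auto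
    have le: "\<bar>(x - y) $ k\<bar> \<le> c k" for k
      unfolding abs_diff using cx[OF xy(1), of k] cx[OF xy(2), of k] by linarith
    have "\<bar>real m * \<bar>x $ i\<bar> / c i - real m * \<bar>y $ i\<bar> / c i\<bar> < 1"
      using xy(3) unfolding q_def by linarith
    then have "real m * \<bar>(x - y) $ i\<bar> / c i < 1"
      unfolding abs_diff using m0 c0[of i]
      by (simp add: abs_mult diff_divide_distrib[symmetric] right_diff_distrib[symmetric])
    then have lei: "\<bar>(x - y) $ i\<bar> \<le> c i / real m" using m0 c0[of i] by (simp add: field_simps)
    have "x - y \<in> L" using xy F full_rank_lattice_diff[OF lattice] by blast
    then have "1 \<le> abs_prod_coords (x - y)" using norm_ge_1 xy(4) by simp
    also have "\<dots> = \<bar>(x - y) $ i\<bar> * (\<Prod>k\<in>UNIV - {i}. \<bar>(x - y) $ k\<bar>)"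
      unfolding abs_prod_coords_eq by (rule prod.remove) auto
    also have "\<dots> \<le> c i / real m * (\<Prod>k\<in>UNIV - {i}. c k)"
      by (intro mult_mono lei prod_mono prod_nonneg) (use le c0 m0 in \<open>auto intro: less_imp_le\<close>)
    also have "\<dots> = V / real m" unfolding V_def by (subst prod.remove[of UNIV i]) auto
    also have "\<dots> < 1" using mV m0 by simp
    finally show False by simp
  qed
  moreover have "q ` F \<subseteq> {int m..<2 * int m}"
  proof clarify
    fix x assume x: "x \<in> F"
    have "real m \<le> real m * \<bar>x $ i\<bar> / c i" "real m * \<bar>x $ i\<bar> / c i < 2 * real m"
      using cx[OF x, of i] m0 c0[of i] by (simp_all add: field_simps)
    then show "q x \<in> {int m..<2 * int m}" unfolding q_def
      by (simp add: le_floor_iff floor_less_iff)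
  qed
  ultimately have "card F \<le> card {int m..<2 * int m}" by (metis card_image card_mono finite_atLeastLessThan_int)
  then have cardF: "real (card F) \<le> V + 1" using mV by simp
  have "(\<Sum>x\<in>F. 1 / abs_prod_coords x) \<le> (\<Sum>x\<in>F. 1 / V)"
    by (intro sum_mono divide_left_mono) (use V_le V0 less_le_trans in \<open>auto intro!: mult_pos_pos\<close>)
  also have "\<dots> = real (card F) / V" by simp
  also have "\<dots> \<le> (V + 1) / V" using cardF V0 by (intro divide_right_mono) auto
  also have "\<dots> = 1 + 1 / V" using V0 by (simp add: field_simps)
  also have "\<dots> \<le> 1 + 2 ^ CARD('n)" using V_ge by simp
  finally show ?thesis .
qed auto

text \<open>Group the points by the signs and dyadic sizes of their coordinates. A coordinate is at
  most \<open>T\<close>, and at least the inverse of a power of \<open>T\<close> because the norm is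
  at least 1; so there are at most about \<open>(log T)^d\<close> boxes, each with bounded
  contribution.\<close>

lemma sum_inverse_norm_le_log:
  assumes T: "T \<ge> 1"
  shows "(\<Sum>x\<in>pts T. 1 / abs_prod_coords x)
    \<le> (4 * (CARD('n) * log 2 T + 1) + 2) ^ CARD('n) * (1 + 2 ^ CARD('n))"
proof -
  define M where "M = \<lceil>CARD('n) * log 2 T\<rceil>"
  have logT: "0 \<le> log 2 T" using T by simp
  define key where "key = (\<lambda>(x :: real ^ 'n) k. (\<lfloor>log 2 \<bar>x $ k\<bar>\<rfloor>, x $ k > 0))"
  define KS where "KS = PiE (UNIV :: 'n set) (\<lambda>_. {- M..M} \<times> (UNIV :: bool set))"
  have key: "key x \<in> KS" if "x \<in> pts T" for x
  proof -
    have "\<lfloor>log 2 \<bar>x $ k\<bar>\<rfloor> \<in> {- M..M}" for k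
    proof -
      have x: "x \<in> L" "x \<noteq> 0" "infnorm x \<le> T" using that by (auto simp: pts_def)
      have xT: "\<bar>x $ l\<bar> \<le> T" for l using x(3) component_le_infnorm_cart[of x l] by simp
      have xk: "\<bar>x $ k\<bar> > 0" using coord_nonzero[OF x(1,2)] by simp
      have "1 \<le> abs_prod_coords x" using norm_ge_1[OF x(1,2)] .
      also have "\<dots> = \<bar>x $ k\<bar> * (\<Prod>l\<in>UNIV - {k}. \<bar>x $ l\<bar>)"
        unfolding abs_prod_coords_eq by (rule prod.remove) auto
      also have "\<dots> \<le> \<bar>x $ k\<bar> * (\<Prod>l\<in>UNIV - {k}. T)"
        by (intro mult_left_mono prod_mono) (use xT in auto)
      also have "\<dots> \<le> \<bar>x $ k\<bar> * T ^ CARD('n)"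
        using T by (intro mult_left_mono) (auto intro: power_increasing)
      finally have "log 2 1 \<le> log 2 (\<bar>x $ k\<bar> * T ^ CARD('n))" by (subst log_le_cancel_iff) auto
      also have "\<dots> = log 2 \<bar>x $ k\<bar> + CARD('n) * log 2 T"
        using xk T by (simp add: log_mult log_nat_power)
      finally have "- (CARD('n) * log 2 T) \<le> log 2 \<bar>x $ k\<bar>" by simp
      moreover have "log 2 \<bar>x $ k\<bar> \<le> log 2 T" using xk xT[of k] T by simp
      moreover have "1 * log 2 T \<le> CARD('n) * log 2 T"
        using logT by (intro mult_right_mono) (auto simp: Suc_le_eq)
      ultimately show ?thesis unfolding M_def by (auto simp: le_floor_iff floor_le_iff ceiling_def) linarith+
    qed
    then show ?thesis unfolding key_def KS_def by auto
  qed
  have "(\<Sum>x\<in>pts T. 1 / abs_prod_coords x) = (\<Sum>\<kappa>\<in>KS. \<Sum>x\<in>{x \<in> pts T. key x = \<kappa>}. 1 / abs_prod_coords x)"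
    by (rule sum.group[symmetric]) (use key finite_pts in \<open>auto simp: KS_def intro!: finite_PiE\<close>)
  also have "\<dots> \<le> (\<Sum>\<kappa>\<in>KS. 1 + 2 ^ CARD('n))"
  proof (intro sum_mono)
    fix \<kappa>
    have "finite {x \<in> pts T. key x = \<kappa>}" using finite_pts by simp
    then show "(\<Sum>x\<in>{x \<in> pts T. key x = \<kappa>}. 1 / abs_prod_coords x) \<le> 1 + 2 ^ CARD('n)"
      by (rule sum_inverse_norm_dyadic_box[of _ "fst \<circ> \<kappa>" "snd \<circ> \<kappa>"]) (auto simp: pts_def key_def)
  qed
  also have "\<dots> = real (card KS) * (1 + 2 ^ CARD('n))" by simp
  also have "real (card KS) = (real (card {- M..M}) * 2) ^ CARD('n)"
    unfolding KS_def by (simp add: card_PiE card_cartesian_product)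
  also have "\<dots> * (1 + 2 ^ CARD('n)) \<le> (4 * (CARD('n) * log 2 T + 1) + 2) ^ CARD('n) * (1 + 2 ^ CARD('n))"
  proof (intro mult_right_mono power_mono)
    have "0 \<le> CARD('n) * log 2 T" using logT by simp
    then have "0 \<le> M" "real_of_int M \<le> CARD('n) * log 2 T + 1" unfolding M_def by linarith+
    then show "real (card {- M..M}) * 2 \<le> 4 * (CARD('n) * log 2 T + 1) + 2" by simp
  qed auto
  finally show ?thesis .
qed

lemma sum_inverse_norm_le:
  assumes "\<epsilon> > 0"
  shows "\<exists>C>0. \<forall>T\<ge>1. (\<Sum>x\<in>pts T. 1 / abs_prod_coords x) \<le> C * T powr \<epsilon>"
proof -
  define d where "d = CARD('n)"
  have d0: "d > 0" by (simp add: d_def)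
  \<comment> \<open>The logarithm is bounded by a multiple of \<open>T powr \<eta>\<close>; its d-th
    power then costs \<open>T powr \<epsilon>\<close>.\<close>
  define \<eta> where "\<eta> = \<epsilon> / d"
  have \<eta>0: "\<eta> > 0" using assms d0 by (simp add: \<eta>_def)
  define A where "A = 4 * d / (\<eta> * ln 2) + 6"
  have A0: "A > 0" unfolding A_def using \<eta>0 by (intro add_nonneg_pos) auto
  have "(\<Sum>x\<in>pts T. 1 / abs_prod_coords x) \<le> (A ^ d * (1 + 2 ^ d)) * T powr \<epsilon>" if T: "T \<ge> 1" for T
  proof -
    have ge1: "1 \<le> T powr \<eta>" using T \<eta>0 by (simp add: ge_one_powr_ge_zero)
    have "ln T \<le> T powr \<eta> / \<eta>" using ln_powr_bound[OF T \<eta>0] .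
    then have "log 2 T \<le> T powr \<eta> / (\<eta> * ln 2)" unfolding log_def by (simp add: field_simps)
    then have "4 * (d * log 2 T + 1) + 2 \<le> 4 * d * (T powr \<eta> / (\<eta> * ln 2)) + 6"
      using mult_left_mono[of "log 2 T" "T powr \<eta> / (\<eta> * ln 2)" "4 * real d"] by (simp add: algebra_simps)
    also have "\<dots> \<le> A * T powr \<eta>" unfolding A_def using ge1 by (simp add: algebra_simps)
    finally have "(4 * (d * log 2 T + 1) + 2) ^ d \<le> (A * T powr \<eta>) ^ d"
      using T by (intro power_mono) (auto intro!: add_nonneg_nonneg)
    also have "\<dots> = A ^ d * T powr \<epsilon>"
      using T d0 by (simp add: power_mult_distrib powr_power \<eta>_def)
    finally have "(4 * (d * log 2 T + 1) + 2) ^ d * (1 + 2 ^ d) \<le> A ^ d * T powr \<epsilon> * (1 + 2 ^ d)"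
      by (intro mult_right_mono) auto
    then show ?thesis using sum_inverse_norm_le_log[OF T] unfolding d_def by (simp add: mult_ac)
  qed
  moreover have "A ^ d * (1 + 2 ^ d) > 0" using A0 by (intro mult_pos_pos) (auto intro: add_pos_nonneg)
  ultimately show ?thesis by blast
qed

text \<open>The slope \<open>r\<close> at which \<open>x $ i - r * x $ j\<close> vanishes.\<close>

definition ratio :: "real ^ 'n \<Rightarrow> real" where "ratio x = x $ i / x $ j"

text \<open>The excluded slopes form intervals of radius \<open>\<kappa> / abs_prod_coords x\<close>
  around the ratios. Their total length is \<open>2 * \<kappa>\<close> times the sum of inverse
  norms, so they cannot cover a longer interval.\<close>

lemma interval_avoids_ratios:
  assumes "\<epsilon> > 0"
  shows "\<exists>C>0. \<forall>T\<ge>1. \<forall>a b \<kappa>. \<kappa> > 0 \<longrightarrow> C * T powr \<epsilon> * \<kappa> < b - a \<longrightarrow>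
    (\<exists>z. a < z \<and> z < b \<and> (\<forall>x\<in>pts T. \<kappa> \<le> \<bar>z - ratio x\<bar> * abs_prod_coords x))"
proof -
  obtain C where C: "C > 0" "\<And>T. T \<ge> 1 \<Longrightarrow> (\<Sum>x\<in>pts T. 1 / abs_prod_coords x) \<le> C * T powr \<epsilon>"
    using sum_inverse_norm_le[OF assms] by blast
  have "\<exists>z. a < z \<and> z < b \<and> (\<forall>x\<in>pts T. \<kappa> \<le> \<bar>z - ratio x\<bar> * abs_prod_coords x)"
    if T: "T \<ge> 1" and \<kappa>: "\<kappa> > 0" and lt: "2 * C * T powr \<epsilon> * \<kappa> < b - a" for T a b \<kappa>
  proof (rule ccontr)
    assume neg: "\<not> ?thesis"
    have N: "abs_prod_coords x > 0" if "x \<in> pts T" for x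
      using that norm_ge_1[of x] by (auto simp: pts_def)
    define I where "I = (\<lambda>x. {ratio x - \<kappa> / abs_prod_coords x..ratio x + \<kappa> / abs_prod_coords x})"
    have "{a<..<b} \<subseteq> (\<Union>x\<in>pts T. I x)"
    proof
      fix z assume "z \<in> {a<..<b}"
      then obtain x where x: "x \<in> pts T" "\<bar>z - ratio x\<bar> * abs_prod_coords x < \<kappa>"
        using neg by force
      then have "\<bar>z - ratio x\<bar> < \<kappa> / abs_prod_coords x" using N by (simp add: field_simps)
      then have "z \<in> I x" unfolding I_def by auto
      then show "z \<in> (\<Union>x\<in>pts T. I x)" using x by blast
    qed
    moreover have fm: "I x \<in> fmeasurable lborel" for x
      unfolding I_def by (intro fmeasurableI) (auto simp: emeasure_lborel_Icc_eq)
    ultimately have "measure lborel {a<..<b} \<le> measure lborel (\<Union>x\<in>pts T. I x)"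
      by (intro measure_mono_fmeasurable fmeasurable.finite_UN finite_pts) auto
    also have "\<dots> \<le> (\<Sum>x\<in>pts T. measure lborel (I x))"
      by (rule measure_UNION_le) (auto simp: finite_pts I_def)
    also have "\<dots> = (\<Sum>x\<in>pts T. 2 * \<kappa> * (1 / abs_prod_coords x))"
      by (intro sum.cong refl) (use N \<kappa> in \<open>auto simp: I_def less_imp_le\<close>)
    also have "\<dots> = 2 * \<kappa> * (\<Sum>x\<in>pts T. 1 / abs_prod_coords x)" by (rule sum_distrib_left[symmetric])
    also have "\<dots> \<le> 2 * \<kappa> * (C * T powr \<epsilon>)" using C(2)[OF T] \<kappa> by (intro mult_left_mono) auto
    also have "\<dots> < b - a" using lt by (simp add: mult_ac)
    finally have "measure lborel {a<..<b} < b - a" .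
    moreover have "a < b" using lt C \<kappa> by (smt (verit) mult_nonneg_nonneg powr_ge_zero)
    ultimately show False by simp
  qed
  then show ?thesis using C(1) by (intro exI[of _ "2 * C"]) auto
qed

section \<open>Approximation of a slope by ratios\<close>

lemma card_ge_2: "CARD('n) \<ge> 2"
  using card_mono[of "UNIV :: 'n set" "{i, j}"] ij by simp

lemma abs_prod_coords_split:
  "abs_prod_coords x = \<bar>x $ i\<bar> * \<bar>x $ j\<bar> * (\<Prod>k\<in>UNIV - {i, j}. \<bar>x $ k\<bar>)"
proof -
  have "abs_prod_coords x = \<bar>x $ i\<bar> * (\<bar>x $ j\<bar> * (\<Prod>k\<in>UNIV - {i} - {j}. \<bar>x $ k\<bar>))"
    unfolding abs_prod_coords_eq using ij
    by (subst prod.remove[of UNIV i]) (auto simp: prod.remove[of "UNIV - {i}" j])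
  also have "UNIV - {i} - {j} = UNIV - {i, j}" by blast
  finally show ?thesis by simp
qed

lemma prod_other_coords_le:
  assumes "infnorm x \<le> T"
  shows "(\<Prod>k\<in>UNIV - {i, j}. \<bar>x $ k\<bar>) \<le> T ^ (CARD('n) - 2)"
proof -
  have "(\<Prod>k\<in>UNIV - {i, j}. \<bar>x $ k\<bar>) \<le> (\<Prod>k\<in>UNIV - {i, j}. T)"
    by (intro prod_mono) (use assms component_le_infnorm_cart[of x] order.trans in auto)
  also have "\<dots> = T ^ (CARD('n) - 2)" using ij by (simp add: card_Diff_subset numeral_2_eq_2)
  finally show ?thesis .
qed

text \<open>Pigeonhole principle: the \<open>(K + 1)^d\<close> combinations with coefficients in
  \<open>{0..K}\<close> take values of the form \<open>x $ i - z * x $ j\<close> in an interval of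
  length proportional to \<open>K\<close>. Cut into \<open>K^d\<close> slots, it has two values in
  one slot, and the difference of the two points is \<open>w\<close>.\<close>

lemma dirichlet:
  "\<exists>C>0. \<exists>X0\<ge>1. \<forall>X\<ge>X0. \<forall>z. \<bar>z\<bar> \<le> 4 \<longrightarrow>
     (\<exists>w\<in>pts X. \<bar>w $ i - z * w $ j\<bar> * X ^ CARD('n) \<le> C * X)"
proof -
  let ?d = "CARD('n)"
  obtain B where B: "independent B" "span B = UNIV"
    and L: "L = {\<Sum>b\<in>B. of_int (k b) *\<^sub>R b | k :: real ^ 'n \<Rightarrow> int. True}"
    using lattice unfolding full_rank_lattice_def by blast
  have finB: "finite B" using B(1) independent_bound by blast
  have cardB: "card B = ?d"
    using dim_span_eq_card_independent[OF B(1)] B(2) by (simp add: dim_UNIV)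
  have B0: "0 \<notin> B" using B(1) dependent_zero by blast
  define lc where "lc = (\<lambda>k :: real ^ 'n \<Rightarrow> int. \<Sum>b\<in>B. of_int (k b) *\<^sub>R b)"
  define C0 where "C0 = (\<Sum>b\<in>B. infnorm b)"
  have "B \<noteq> {}" using cardB by auto
  then have C0: "C0 > 0" unfolding C0_def
    by (intro sum_pos finB) (use B0 in \<open>auto simp: infnorm_pos_lt\<close>)
  have coord_le: "\<bar>b $ l\<bar> \<le> infnorm b" for b :: "real ^ 'n" and l by (rule component_le_infnorm_cart)
  have lc_coord: "\<bar>lc k $ l\<bar> \<le> C0 * of_int K" if "\<And>b. b \<in> B \<Longrightarrow> \<bar>k b\<bar> \<le> K" for k l K
  proof -
    have "\<bar>lc k $ l\<bar> \<le> (\<Sum>b\<in>B. \<bar>of_int (k b) * b $ l\<bar>)"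
      unfolding lc_def sum_component by (simp add: sum_abs)
    also have "\<dots> \<le> (\<Sum>b\<in>B. of_int K * infnorm b)"
    proof (intro sum_mono)
      fix b assume "b \<in> B"
      then have "\<bar>real_of_int (k b)\<bar> \<le> of_int K" using that[of b] by linarith
      then show "\<bar>of_int (k b) * b $ l\<bar> \<le> of_int K * infnorm b"
        unfolding abs_mult by (intro mult_mono coord_le) auto
    qed
    also have "\<dots> = C0 * of_int K" unfolding C0_def by (simp add: sum_distrib_left mult.commute)
    finally show ?thesis .
  qed
  have main: "\<exists>w\<in>pts X. \<bar>w $ i - z * w $ j\<bar> * X ^ ?d \<le> (11 * (2 * C0) ^ ?d) * X"
    if X: "X \<ge> max 1 (2 * C0)" and z: "\<bar>z\<bar> \<le> 4" for X z
  proof -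
    \<comment> \<open>The largest \<open>K\<close> for which coefficients of size at most
      \<open>K\<close> keep the norm below \<open>X\<close>; up to a constant, \<open>K\<close> is
      \<open>X\<close>.\<close>
    define K where "K = nat \<lfloor>X / C0\<rfloor>"
    have "X / C0 \<ge> 2" using X C0 by (simp add: field_simps)
    then have K: "K \<ge> 1" "real K \<le> X / C0" "X / C0 \<le> 2 * real K" unfolding K_def by linarith+
    have KX: "C0 * real K \<le> X" "X \<le> 2 * C0 * real K" using K(2,3) C0 by (simp_all add: field_simps)
    define S where "S = PiE B (\<lambda>_. {0..int K})"
    have finS: "finite S" unfolding S_def by (intro finite_PiE finB) auto
    have cardS: "card S = (K + 1) ^ ?d"
      unfolding S_def using finB cardB by (simp add: card_PiE nat_add_distrib)
    define \<phi> where "\<phi> = (\<lambda>k. lc k $ i - z * lc k $ j)"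
    have \<phi>_le: "\<bar>\<phi> k\<bar> \<le> 5 * (C0 * real K)" if "\<And>b. b \<in> B \<Longrightarrow> \<bar>k b\<bar> \<le> int K" for k
    proof -
      have "\<bar>\<phi> k\<bar> \<le> \<bar>lc k $ i\<bar> + \<bar>z\<bar> * \<bar>lc k $ j\<bar>" unfolding \<phi>_def
        by (metis abs_mult abs_triangle_ineq4)
      also have "\<dots> \<le> C0 * real K + 4 * (C0 * real K)"
        by (intro add_mono mult_mono) (use lc_coord[of k "int K"] that z C0 in auto)
      finally show ?thesis by simp
    qed
    define m where "m = K ^ ?d"
    have m0: "m > 0" using K(1) by (simp add: m_def)
    \<comment> \<open>Slightly more than the length \<open>10 * (C0 * real K)\<close> of the range
      of \<open>\<phi>\<close>, so that the slot number stays strictly below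
      \<open>m\<close>.\<close>
    define D where "D = 11 * (C0 * real K)"
    have D0: "D > 0" using C0 K(1) by (simp add: D_def)
    define q where "q = (\<lambda>k. \<lfloor>(\<phi> k + 5 * (C0 * real K)) * real m / D\<rfloor>)"
    have "q ` S \<subseteq> {0..<int m}"
    proof clarify
      fix k assume "k \<in> S"
      then have "\<bar>\<phi> k\<bar> \<le> 5 * (C0 * real K)"
        by (intro \<phi>_le) (auto simp: S_def PiE_def Pi_def)
      then have "0 \<le> \<phi> k + 5 * (C0 * real K)" "\<phi> k + 5 * (C0 * real K) < D"
        using D0 unfolding D_def by linarith+
      moreover have "0 \<le> y * real m / D \<and> y * real m / D < real m" if "0 \<le> y" "y < D" for y
        using that D0 m0 by (simp add: pos_divide_less_eq mult.commute)
      ultimately have "0 \<le> (\<phi> k + 5 * (C0 * real K)) * real m / D" "(\<phi> k + 5 * (C0 * real K)) * real m / D < real m"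
        by blast+
      then show "q k \<in> {0..<int m}" unfolding q_def by (simp add: le_floor_iff floor_less_iff)
    qed
    then have "card (q ` S) \<le> m" using card_mono[of "{0..<int m}" "q ` S"] by simp
    also have "\<dots> < card S" unfolding cardS m_def by (intro power_strict_mono) auto
    finally have "\<not> inj_on q S" by (rule pigeonhole)
    then obtain k l where kl: "k \<in> S" "l \<in> S" "k \<noteq> l" "q k = q l" by (auto simp: inj_on_def)
    define w where "w = lc (\<lambda>b. k b - l b)"
    have w_eq: "w = lc k - lc l" unfolding w_def lc_def
      by (simp add: sum_subtractf scaleR_left_diff_distrib)
    have wL: "w \<in> L" unfolding w_def lc_def L by (intro CollectI exI[of _ "\<lambda>b. k b - l b"]) simp
    have w0: "w \<noteq> 0"
    proof
      assume "w = 0"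
      then have "(\<Sum>b\<in>B. of_int (k b - l b) *\<^sub>R b) = 0" unfolding w_def lc_def .
      then have "real_of_int (k b - l b) = 0" if "b \<in> B" for b
        using independentD[OF B(1) finB subset_refl _ that, of "\<lambda>b. of_int (k b - l b)"] by simp
      then have "k b = l b" if "b \<in> B" for b using that by fastforce
      then have "k = l" using kl(1,2) unfolding S_def by (intro PiE_ext) auto
      then show False using kl(3) by simp
    qed
    have "\<bar>k b - l b\<bar> \<le> int K" if "b \<in> B" for b
    proof -
      have "k b \<in> {0..int K}" "l b \<in> {0..int K}" using kl(1,2) that by (auto simp: S_def PiE_def Pi_def)
      then show ?thesis by auto
    qed
    then have "\<bar>w $ n\<bar> \<le> C0 * real K" for n
      unfolding w_def using lc_coord[of "\<lambda>b. k b - l b" "int K" n] by simp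
    then have "\<bar>w $ n\<bar> \<le> X" for n using KX(1) order.trans by blast
    then have "infnorm w \<le> X" unfolding infnorm_le_iff_cart by blast
    then have wX: "w \<in> pts X" using wL w0 by (simp add: pts_def)
    have "\<bar>(\<phi> k + 5 * (C0 * real K)) * real m / D - (\<phi> l + 5 * (C0 * real K)) * real m / D\<bar> < 1"
      using kl(4) unfolding q_def by linarith
    also have "(\<phi> k + 5 * (C0 * real K)) * real m / D - (\<phi> l + 5 * (C0 * real K)) * real m / D
        = (\<phi> k - \<phi> l) * real m / D"
      by (simp add: diff_divide_distrib[symmetric] algebra_simps)
    finally have "\<bar>\<phi> k - \<phi> l\<bar> * real m / D < 1" using D0 by (simp add: abs_mult)
    then have "\<bar>\<phi> k - \<phi> l\<bar> * real m < D" using D0 by (simp add: pos_divide_less_eq)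
    moreover have "\<phi> k - \<phi> l = w $ i - z * w $ j" unfolding \<phi>_def w_eq by (simp add: algebra_simps)
    ultimately have small: "\<bar>w $ i - z * w $ j\<bar> * real K ^ ?d \<le> 11 * (C0 * real K)"
      unfolding m_def D_def by simp
    have "X ^ ?d \<le> (2 * C0 * real K) ^ ?d" using X KX(2) by (intro power_mono) auto
    then have "\<bar>w $ i - z * w $ j\<bar> * X ^ ?d \<le> (2 * C0) ^ ?d * (\<bar>w $ i - z * w $ j\<bar> * real K ^ ?d)"
      using mult_left_mono[of "X ^ ?d" "(2 * C0 * real K) ^ ?d" "\<bar>w $ i - z * w $ j\<bar>"]
      by (simp add: power_mult_distrib mult_ac)
    also have "\<dots> \<le> (2 * C0) ^ ?d * (11 * (C0 * real K))" using small C0 by (intro mult_left_mono) auto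
    also have "\<dots> \<le> (2 * C0) ^ ?d * (11 * X)" using KX(1) C0 by (intro mult_left_mono) auto
    finally show ?thesis using wX by (intro bexI[of _ w]) (simp_all add: mult_ac)
  qed
  show ?thesis
    by (rule exI[of _ "11 * (2 * C0) ^ ?d"], intro conjI exI[of _ "max 1 (2 * C0)"]) (use main C0 in auto)
qed

text \<open>Dividing the bound of \<open>dirichlet\<close> by \<open>w $ j\<close> requires
  \<open>w $ j\<close> to be large. Since \<open>z\<close> is far from the ratio of
  \<open>w\<close>, the small value of \<open>w $ i - z * w $ j\<close> must be compensated by a
  large \<open>w $ i\<close>, of size at least about \<open>X powr (1 - \<delta>)\<close>; then
  \<open>w $ j\<close> is also large, as \<open>w $ i\<close> is close to \<open>z * w $ j\<close>
  and \<open>z\<close> is bounded.\<close>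

lemma ratio_approximation:
  assumes \<delta>: "0 < \<delta>" "\<delta> < 1"
  shows "\<exists>C>0. \<exists>X0\<ge>1. \<forall>X\<ge>X0. \<forall>z. \<bar>z\<bar> \<le> 4 \<longrightarrow>
    (\<forall>x\<in>pts X. X powr - \<delta> \<le> \<bar>z - ratio x\<bar> * abs_prod_coords x) \<longrightarrow>
    (\<exists>w\<in>pts X. \<bar>z - ratio w\<bar> \<le> C * X powr (\<delta> - real CARD('n)))"
proof -
  let ?d = "CARD('n)"
  obtain C X0 where C: "C > 0" "X0 \<ge> 1"
    and dir: "\<And>X z. X \<ge> X0 \<Longrightarrow> \<bar>z\<bar> \<le> 4 \<Longrightarrow> \<exists>w\<in>pts X. \<bar>w $ i - z * w $ j\<bar> * X ^ ?d \<le> C * X"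
    using dirichlet by blast
  have "filterlim (\<lambda>X::real. X powr (1 - \<delta>)) at_top at_top" using \<delta> by real_asymp
  \<comment> \<open>This absorbs the additive \<open>C\<^sup>2\<close> that remains when
    \<open>w $ i\<close> is replaced by \<open>w $ j\<close>.\<close>
  then have "eventually (\<lambda>X. 2 * C\<^sup>2 \<le> X powr (1 - \<delta>)) at_top" by (simp add: filterlim_at_top)
  then obtain X1 where X1: "\<And>X. X \<ge> X1 \<Longrightarrow> 2 * C\<^sup>2 \<le> X powr (1 - \<delta>)"
    by (auto simp: eventually_at_top_linorder)
  have "\<exists>w\<in>pts X. \<bar>z - ratio w\<bar> \<le> 8 * C\<^sup>2 * X powr (\<delta> - ?d)"
    if X: "X \<ge> max X0 X1" and z: "\<bar>z\<bar> \<le> 4"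
      and good: "\<And>x. x \<in> pts X \<Longrightarrow> X powr - \<delta> \<le> \<bar>z - ratio x\<bar> * abs_prod_coords x" for X z
  proof -
    have X_ge1: "X \<ge> 1" using X C by simp
    obtain w where w: "w \<in> pts X" "\<bar>w $ i - z * w $ j\<bar> * X ^ ?d \<le> C * X" using dir[of X z] X z by auto
    have wj: "w $ j \<noteq> 0" using w(1) coord_nonzero by (auto simp: pts_def)
    define y where "y = \<bar>w $ i - z * w $ j\<bar>"
    have y0: "y \<ge> 0" by (simp add: y_def)
    have "(z - ratio w) * w $ j = - (w $ i - z * w $ j)" unfolding ratio_def using wj by (simp add: field_simps)
    then have y_eq: "\<bar>z - ratio w\<bar> * \<bar>w $ j\<bar> = y"
      unfolding y_def by (metis abs_minus abs_mult)
    have Xd: "X ^ ?d = X * (X * X ^ (?d - 2))"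
      using card_ge_2 by (metis Suc_diff_Suc Suc_le_eq diff_Suc_Suc diff_zero le_add_diff_inverse numeral_2_eq_2 add_2_eq_Suc power_Suc)
    have "X powr - \<delta> \<le> \<bar>z - ratio w\<bar> * abs_prod_coords w" by (rule good[OF w(1)])
    also have "\<dots> = y * \<bar>w $ i\<bar> * (\<Prod>k\<in>UNIV - {i, j}. \<bar>w $ k\<bar>)"
      unfolding abs_prod_coords_split y_eq[symmetric] by (simp add: mult_ac)
    also have "\<dots> \<le> y * \<bar>w $ i\<bar> * X ^ (?d - 2)"
      using prod_other_coords_le[of w X] w(1) y0 by (intro mult_left_mono) (auto simp: pts_def)
    finally have "X powr - \<delta> * (X * X) \<le> y * \<bar>w $ i\<bar> * X ^ (?d - 2) * (X * X)"
      using X_ge1 by (intro mult_right_mono) auto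
    also have "\<dots> = (y * X ^ ?d) * \<bar>w $ i\<bar>" unfolding Xd by (simp add: mult_ac)
    also have "\<dots> \<le> C * X * \<bar>w $ i\<bar>" using w(2) unfolding y_def by (intro mult_right_mono) auto
    finally have "X powr - \<delta> * X \<le> C * \<bar>w $ i\<bar>" using X_ge1 by (simp add: mult_ac)
    moreover have "X powr - \<delta> * X = X powr (1 - \<delta>)" using X_ge1 by (simp add: powr_diff powr_minus divide_inverse)
    ultimately have wi: "X powr (1 - \<delta>) \<le> C * \<bar>w $ i\<bar>" by simp
    have "y * X \<le> y * X ^ ?d"
      using X_ge1 y0 card_ge_2 power_increasing[of 1 ?d X] by (intro mult_left_mono) auto
    then have "y * X \<le> C * X" using w(2) unfolding y_def by linarith
    then have yC: "y \<le> C" using X_ge1 by simp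
    have "\<bar>w $ i\<bar> \<le> \<bar>z * w $ j\<bar> + y" unfolding y_def by linarith
    also have "\<dots> \<le> 4 * \<bar>w $ j\<bar> + C" unfolding abs_mult using z yC by (intro add_mono mult_right_mono) auto
    finally have "C * \<bar>w $ i\<bar> \<le> C * (4 * \<bar>w $ j\<bar> + C)" using C by (intro mult_left_mono) auto
    then have "X powr (1 - \<delta>) \<le> 4 * C * \<bar>w $ j\<bar> + C\<^sup>2" using wi by (simp add: algebra_simps power2_eq_square)
    then have wj_ge: "X powr (1 - \<delta>) \<le> 8 * C * \<bar>w $ j\<bar>" using X1[of X] X by linarith
    have "\<bar>z - ratio w\<bar> * X powr (1 - \<delta>) \<le> \<bar>z - ratio w\<bar> * (8 * C * \<bar>w $ j\<bar>)"
      by (intro mult_left_mono wj_ge) auto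
    also have "\<dots> = 8 * C * y" unfolding y_eq[symmetric] by (simp add: mult_ac)
    finally have "\<bar>z - ratio w\<bar> * X powr (1 - \<delta>) * X ^ ?d \<le> 8 * C * (y * X ^ ?d)"
      using X_ge1 by (metis mult.assoc mult_right_mono zero_le_power order.trans zero_le_one)
    also have "\<dots> \<le> 8 * C * (C * X)" using w(2) C unfolding y_def by (intro mult_left_mono) auto
    finally have *: "\<bar>z - ratio w\<bar> * (X powr (1 - \<delta>) * X ^ ?d) \<le> 8 * C\<^sup>2 * X"
      by (simp add: power2_eq_square mult_ac)
    have "X powr (1 - \<delta>) * X ^ ?d = X * X powr (?d - \<delta>)"
      using X_ge1 by (simp add: powr_realpow[symmetric] powr_add[symmetric] powr_mult_base algebra_simps)
    then have "\<bar>z - ratio w\<bar> * X powr (?d - \<delta>) \<le> 8 * C\<^sup>2"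
      using * X_ge1 by (simp add: mult.left_commute)
    then have "\<bar>z - ratio w\<bar> \<le> 8 * C\<^sup>2 / X powr (?d - \<delta>)" using X_ge1 by (simp add: pos_le_divide_eq)
    also have "\<dots> = 8 * C\<^sup>2 * X powr (\<delta> - ?d)"
      by (simp add: powr_minus_divide[symmetric] divide_inverse powr_minus[symmetric])
    finally show ?thesis using w(1) by blast
  qed
  moreover have "8 * C\<^sup>2 > 0" using C by simp
  moreover have "max X0 X1 \<ge> 1" using C by simp
  ultimately show ?thesis by blast
qed

section \<open>Choice of the slopes\<close>

lemma open_good_points: "open {s. \<forall>x\<in>pts T. \<kappa> < \<bar>s - ratio x\<bar> * abs_prod_coords x}"
proof -
  have "{s. \<forall>x\<in>pts T. \<kappa> < \<bar>s - ratio x\<bar> * abs_prod_coords x}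
      = (\<Inter>x\<in>pts T. {s. \<kappa> < \<bar>s - ratio x\<bar> * abs_prod_coords x})" by blast
  also have "open \<dots>"
    by (intro open_INT finite_pts ballI open_Collect_less continuous_intros)
  finally show ?thesis .
qed

text \<open>The minimum of the product over the points of norm at most \<open>t\<close> is kept small by \<^term>\<open>v\<close> until
  time \<open>T powr (1 + \<delta>)\<close>, when \<open>w\<close> takes over; at time \<open>T\<close> no point makes it smaller than necessary.
  The roles of the two intervals are then exchanged.\<close>

lemma refine_intervals:
  assumes v: "v \<in> L" "v \<noteq> 0" and \<nu>: "\<nu> \<ge> 0" and \<delta>: "0 < \<delta>" "\<delta> \<le> 1"
    and S: "p < ratio v" "ratio v < q" and U: "1 \<le> p'" "p' < q'" "q' \<le> 4"
  shows "\<exists>T w a b a' b'. K \<le> T \<and> 1 \<le> T \<and> w \<in> L \<and> w \<noteq> 0 \<and> infnorm w \<le> T powr (1 + \<delta>) \<and>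
     p \<le> a \<and> a < b \<and> b \<le> q \<and> p' \<le> a' \<and> a' < ratio w \<and> ratio w < b' \<and> b' \<le> q' \<and>
     (\<forall>s\<in>{a..b}. \<bar>s - ratio v\<bar> * infnorm v ^ CARD('n) \<le> T powr - \<nu>) \<and>
     (\<forall>s\<in>{a..b} \<union> {a'..b'}. \<forall>x\<in>pts T. T powr (- \<nu> - \<delta>) < \<bar>s - ratio x\<bar> * abs_prod_coords x)"
proof -
  define d where "d = real CARD('n)"
  have d2: "d \<ge> 2" using card_ge_2 by (simp add: d_def)
  \<comment> \<open>\<open>\<delta>0\<close> measures how far the auxiliary slope \<open>z\<close>
    is kept from all ratios; \<open>\<epsilon>\<close>, the loss in counting excluded slopes, is
    smaller.\<close>
  define \<delta>0 where "\<delta>0 = \<delta> / 8"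
  define \<epsilon> where "\<epsilon> = \<delta> / 16"
  have \<delta>0: "0 < \<delta>0" "\<delta>0 < 1" using \<delta> by (auto simp: \<delta>0_def)
  have \<epsilon>: "\<epsilon> > 0" using \<delta> by (simp add: \<epsilon>_def)
  \<comment> \<open>\<open>z\<close> is taken in the middle third of the target interval, so that a
    ratio within \<open>l\<close> of \<open>z\<close> stays inside.\<close>
  define l where "l = (q' - p') / 3"
  have l0: "l > 0" using U by (simp add: l_def)
  define D where "D = infnorm v ^ CARD('n)"
  have D0: "D > 0" using v by (simp add: D_def infnorm_pos_lt)
  \<comment> \<open>The first bound makes slopes within \<open>r * T powr - \<nu>\<close> of
    \<open>ratio v\<close> small after multiplication by \<open>D\<close>; the second keeps them
    below \<open>q\<close>.\<close>
  define r where "r = min (1 / D) (q - ratio v)"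
  have r0: "r > 0" using D0 S by (simp add: r_def)
  obtain CF where CF: "CF > 0" and avoid: "\<And>T a b \<kappa>. T \<ge> 1 \<Longrightarrow> \<kappa> > 0 \<Longrightarrow> CF * T powr \<epsilon> * \<kappa> < b - a \<Longrightarrow>
     \<exists>z. a < z \<and> z < b \<and> (\<forall>x\<in>pts T. \<kappa> \<le> \<bar>z - ratio x\<bar> * abs_prod_coords x)"
    using interval_avoids_ratios[OF \<epsilon>] by blast
  obtain CA X0 where CA: "CA > 0" "X0 \<ge> 1" and approx: "\<And>X z. X \<ge> X0 \<Longrightarrow> \<bar>z\<bar> \<le> 4 \<Longrightarrow>
     (\<And>x. x \<in> pts X \<Longrightarrow> X powr - \<delta>0 \<le> \<bar>z - ratio x\<bar> * abs_prod_coords x) \<Longrightarrow>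
     \<exists>w\<in>pts X. \<bar>z - ratio w\<bar> \<le> CA * X powr (\<delta>0 - d)"
    using ratio_approximation[OF \<delta>0] unfolding d_def by blast
  \<comment> \<open>In order, these ensure that \<open>z\<close> exists, that \<open>ratio w\<close>
    is within \<open>l\<close> of \<open>z\<close>, that moving from \<open>z\<close> to
    \<open>ratio w\<close> costs at most half of the margin \<open>X powr - \<delta>0\<close>, that
    \<open>\<kappa>\<close> is below the other half, and that the window next to
    \<open>ratio v\<close> is longer than the excluded slopes.\<close>
  have exps: "(1 + \<delta>) * (\<epsilon> - \<delta>0) < 0" "(1 + \<delta>) * (\<delta>0 - d) < 0" "(1 + \<delta>) * (2 * \<delta>0 - d) + d < 0"
    "- \<nu> - \<delta> + (1 + \<delta>) * \<delta>0 < 0" "\<epsilon> - \<delta> < 0"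
  proof -
    show "(1 + \<delta>) * (\<epsilon> - \<delta>0) < 0" "(1 + \<delta>) * (\<delta>0 - d) < 0"
      using \<delta> d2 by (auto simp: \<epsilon>_def \<delta>0_def mult_less_0_iff)
    have sq: "\<delta> * \<delta> \<le> \<delta>" using \<delta> by (simp add: mult_left_le)
    have dd: "2 * \<delta> \<le> \<delta> * d" using mult_left_mono[OF d2, of \<delta>] \<delta> by simp
    have eqs: "(1 + \<delta>) * (2 * \<delta>0 - d) + d = \<delta> / 4 + \<delta> * \<delta> / 4 - \<delta> * d"
      "- \<nu> - \<delta> + (1 + \<delta>) * \<delta>0 = - \<nu> - \<delta> + \<delta> / 8 + \<delta> * \<delta> / 8"
      unfolding \<delta>0_def by (simp_all add: algebra_simps)
    show "(1 + \<delta>) * (2 * \<delta>0 - d) + d < 0" unfolding eqs using sq dd \<delta> by linarith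
    show "- \<nu> - \<delta> + (1 + \<delta>) * \<delta>0 < 0" unfolding eqs using sq \<delta> \<nu> by linarith
    show "\<epsilon> - \<delta> < 0" using \<delta> by (simp add: \<epsilon>_def)
  qed
  have "eventually (\<lambda>T. T \<ge> max K X0 \<and> CF * T powr ((1 + \<delta>) * (\<epsilon> - \<delta>0)) < l
      \<and> CA * T powr ((1 + \<delta>) * (\<delta>0 - d)) < l
      \<and> CA * T powr ((1 + \<delta>) * (2 * \<delta>0 - d) + d) < 1 / 2
      \<and> 1 * T powr (- \<nu> - \<delta> + (1 + \<delta>) * \<delta>0) < 1 / 2
      \<and> (2 * CF) * T powr (\<epsilon> - \<delta>) < r) at_top"
    by (intro eventually_conj eventually_ge_at_top eventually_powr_small exps) (use l0 r0 in auto)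
  from eventually_happens'[OF trivial_limit_at_top_linorder this] obtain T where T: "T \<ge> K" "T \<ge> X0"
    and c1: "CF * T powr ((1 + \<delta>) * (\<epsilon> - \<delta>0)) < l"
    and c2: "CA * T powr ((1 + \<delta>) * (\<delta>0 - d)) < l"
    and c3: "CA * T powr ((1 + \<delta>) * (2 * \<delta>0 - d) + d) < 1 / 2"
    and c4: "T powr (- \<nu> - \<delta> + (1 + \<delta>) * \<delta>0) < 1 / 2"
    and c5: "2 * CF * T powr (\<epsilon> - \<delta>) < r"
    by auto
  have T1: "T \<ge> 1" using T CA by simp
  define X where "X = T powr (1 + \<delta>)"
  have XT: "X \<ge> T" unfolding X_def using powr_mono[of 1 "1 + \<delta>" T] T1 \<delta> by simp
  have X1: "X \<ge> 1" using XT T1 by simp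
  have X_powr: "X powr y = T powr ((1 + \<delta>) * y)" for y unfolding X_def by (simp add: powr_powr)
  define \<kappa> where "\<kappa> = T powr (- \<nu> - \<delta>)"
  have \<kappa>0: "\<kappa> > 0" using T1 by (simp add: \<kappa>_def)

  have "CF * X powr \<epsilon> * X powr - \<delta>0 = CF * T powr ((1 + \<delta>) * (\<epsilon> - \<delta>0))"
    unfolding X_powr by (simp add: mult.assoc powr_add[symmetric] algebra_simps)
  also have "\<dots> < (q' - l) - (p' + l)" using c1 by (simp add: l_def field_simps)
  finally obtain z where z: "p' + l < z" "z < q' - l"
    and z_good: "\<And>x. x \<in> pts X \<Longrightarrow> X powr - \<delta>0 \<le> \<bar>z - ratio x\<bar> * abs_prod_coords x"
    using avoid[of X "X powr - \<delta>0" "q' - l" "p' + l"] X1 by auto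
  have z4: "\<bar>z\<bar> \<le> 4" using z U l0 by auto
  obtain w where w: "w \<in> pts X" "\<bar>z - ratio w\<bar> \<le> CA * X powr (\<delta>0 - d)"
    using approx[OF _ z4 z_good] T XT by auto
  have zw: "\<bar>z - ratio w\<bar> < l" using w(2) c2 unfolding X_powr by linarith
  have w_in: "p' < ratio w" "ratio w < q'" using zw z by linarith+
  \<comment> \<open>\<open>ratio w\<close> inherits the distance of \<open>z\<close> from the ratios
    of points of norm at most \<open>T\<close>: the shift is at most
    \<open>CA * X powr (\<delta>0 - d)\<close>, and the norms are at most
    \<open>T powr d\<close>.\<close>
  have w_good: "\<kappa> < \<bar>ratio w - ratio x\<bar> * abs_prod_coords x" if x: "x \<in> pts T" for x
  proof -
    have N0: "0 \<le> abs_prod_coords x" by (simp add: abs_prod_coords_def)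
    have N: "abs_prod_coords x \<le> T powr d"
      using abs_prod_coords_le_power[of x T] x T1 by (simp add: pts_def d_def powr_realpow)
    have "X powr - \<delta>0 \<le> \<bar>z - ratio x\<bar> * abs_prod_coords x"
      using z_good[of x] x XT by (simp add: pts_def)
    also have "\<dots> \<le> (\<bar>ratio w - ratio x\<bar> + \<bar>z - ratio w\<bar>) * abs_prod_coords x"
      by (intro mult_right_mono N0) linarith
    also have "\<dots> \<le> \<bar>ratio w - ratio x\<bar> * abs_prod_coords x + CA * X powr (\<delta>0 - d) * T powr d"
      unfolding distrib_right using w(2) N N0 CA by (intro add_left_mono mult_mono) auto
    also have "CA * X powr (\<delta>0 - d) * T powr d = CA * T powr ((1 + \<delta>) * (2 * \<delta>0 - d) + d) * X powr - \<delta>0"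
      unfolding X_powr by (simp add: mult.assoc powr_add[symmetric] algebra_simps)
    also have "\<dots> \<le> 1 / 2 * X powr - \<delta>0" using c3 by (intro mult_right_mono) auto
    finally have "1 / 2 * X powr - \<delta>0 \<le> \<bar>ratio w - ratio x\<bar> * abs_prod_coords x" by simp
    moreover have "\<kappa> = T powr (- \<nu> - \<delta> + (1 + \<delta>) * \<delta>0) * X powr - \<delta>0"
      unfolding \<kappa>_def X_powr powr_add[symmetric] by simp
    moreover have "\<dots> < 1 / 2 * X powr - \<delta>0" using c4 X1 by (intro mult_strict_right_mono) auto
    ultimately show ?thesis by linarith
  qed

  \<comment> \<open>The new slope is sought in a window of this length to the right of
    \<open>ratio v\<close>. Asking for \<open>2 * \<kappa>\<close> there leaves a strict inequality
    with \<open>\<kappa>\<close>, an open condition.\<close>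
  define \<eta> where "\<eta> = r * T powr - \<nu>"
  have "CF * T powr \<epsilon> * (2 * \<kappa>) = 2 * CF * T powr (\<epsilon> - \<delta>) * T powr - \<nu>"
    unfolding \<kappa>_def by (simp add: mult.assoc powr_add[symmetric] algebra_simps)
  also have "\<dots> < \<eta>" unfolding \<eta>_def using c5 T1 by (intro mult_strict_right_mono) auto
  finally obtain s where s: "ratio v < s" "s < ratio v + \<eta>"
    and s_good': "\<And>x. x \<in> pts T \<Longrightarrow> 2 * \<kappa> \<le> \<bar>s - ratio x\<bar> * abs_prod_coords x"
    using avoid[of T "2 * \<kappa>" "ratio v + \<eta>" "ratio v"] T1 \<kappa>0 by auto
  have s_good: "\<kappa> < \<bar>s - ratio x\<bar> * abs_prod_coords x" if "x \<in> pts T" for x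
    using s_good'[OF that] \<kappa>0 by linarith
  have T\<nu>: "0 < T powr - \<nu>" "T powr - \<nu> \<le> 1"
    using T1 \<nu> powr_mono[of "- \<nu>" 0 T] by auto
  have "\<eta> \<le> r * 1" unfolding \<eta>_def using T\<nu> r0 by (intro mult_left_mono) auto
  moreover have "r \<le> q - ratio v" unfolding r_def by simp
  ultimately have \<eta>q: "ratio v + \<eta> \<le> q" by linarith
  have "\<eta> \<le> 1 / D * T powr - \<nu>" unfolding \<eta>_def r_def using T\<nu> by (intro mult_right_mono) auto
  then have \<eta>D: "\<eta> * D \<le> T powr - \<nu>" using D0 by (simp add: field_simps)

  define G where "G = {s. \<forall>x\<in>pts T. \<kappa> < \<bar>s - ratio x\<bar> * abs_prod_coords x}"
  have G: "open G" unfolding G_def by (rule open_good_points)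
  obtain a b where ab: "ratio v \<le> a" "a < s" "s < b" "b \<le> ratio v + \<eta>" "{a..b} \<subseteq> G"
    by (rule interval_around[OF G _ s]) (use s_good in \<open>auto simp: G_def\<close>)
  obtain a' b' where ab': "p' \<le> a'" "a' < ratio w" "ratio w < b'" "b' \<le> q'" "{a'..b'} \<subseteq> G"
    by (rule interval_around[OF G _ w_in]) (use w_good in \<open>auto simp: G_def\<close>)
  have "\<bar>t - ratio v\<bar> * D \<le> T powr - \<nu>" if "t \<in> {a..b}" for t
  proof -
    have "\<bar>t - ratio v\<bar> \<le> \<eta>" using that ab by auto
    then have "\<bar>t - ratio v\<bar> * D \<le> \<eta> * D" using D0 by (intro mult_right_mono) auto
    then show ?thesis using \<eta>D by linarith
  qed
  moreover have "\<kappa> < \<bar>t - ratio x\<bar> * abs_prod_coords x" if "t \<in> {a..b} \<union> {a'..b'}" "x \<in> pts T" for t x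
    using that ab(5) ab'(5) unfolding G_def by blast
  ultimately show ?thesis
    using T(1) T1 w(1) order.trans[OF less_imp_le[OF S(1)] ab(1)] less_trans[OF ab(2,3)]
      order.trans[OF ab(4) \<eta>q] ab'(1-4) unfolding pts_def X_def \<kappa>_def D_def
    by (intro exI[of _ T] exI[of _ w] exI[of _ a] exI[of _ b] exI[of _ a'] exI[of _ b']) blast
qed

text \<open>By \<open>abs_prod_coords_shear_upper\<close>, such a point makes the sheared product at
  most a constant times \<open>t powr - \<alpha>\<close>.\<close>

definition covers :: "real \<Rightarrow> real \<Rightarrow> real \<Rightarrow> real \<Rightarrow> bool" where
  "covers \<alpha> s u t \<longleftrightarrow> (\<exists>x\<in>pts t. min \<bar>s - ratio x\<bar> \<bar>u - ratio x\<bar> * infnorm x ^ CARD('n) \<le> t powr - \<alpha>)"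

text \<open>The hypotheses of \<open>abs_prod_coords_shear_lower\<close> for all points of norm at
  most \<open>T\<close>: the sheared product is never much smaller than
  \<open>T powr - \<beta>\<close>.\<close>

definition sharp :: "real \<Rightarrow> real \<Rightarrow> real \<Rightarrow> real \<Rightarrow> bool" where
  "sharp \<beta> s u T \<longleftrightarrow> (\<forall>x\<in>pts T. T powr - \<beta> < \<bar>s - ratio x\<bar> * abs_prod_coords x
     \<and> T powr - \<beta> < \<bar>u - ratio x\<bar> * abs_prod_coords x)"

text \<open>After two refinements with exchanged roles the first interval again contains a ratio in
  its interior, so the step can be iterated. The point \<open>v\<close> covers the times up to
  \<open>T powr (1 + \<delta>)\<close>, then \<open>w\<close> takes over until
  \<open>\<tau>\<close>, when \<open>v'\<close> is available.\<close>

lemma refine_intervals_twice: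
  assumes v: "v \<in> L" "v \<noteq> 0" and \<nu>: "\<nu> \<ge> 0" and \<delta>: "0 < \<delta>" "\<delta> \<le> 1"
    and S: "1 \<le> p" "p < ratio v" "ratio v < q" "q \<le> 4" and U: "1 \<le> p'" "p' < q'" "q' \<le> 4"
  shows "\<exists>v' a b a' b' \<tau>. v' \<in> L \<and> v' \<noteq> 0 \<and> p \<le> a \<and> a < ratio v' \<and> ratio v' < b \<and> b \<le> q \<and>
     p' \<le> a' \<and> a' < b' \<and> b' \<le> q' \<and> K \<le> \<tau> \<and> infnorm v' \<le> \<tau> \<and>
     (\<forall>s\<in>{a..b}. \<forall>u\<in>{a'..b'}. (\<forall>t. infnorm v \<le> t \<longrightarrow> 1 \<le> t \<longrightarrow> t \<le> \<tau> \<longrightarrow> covers (\<nu> / (1 + \<delta>)) s u t)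
        \<and> (\<exists>T\<ge>max 1 K. sharp (\<nu> + \<delta>) s u T))"
proof -
  let ?d = "CARD('n)"
  obtain T w a b a' b' where 1: "K \<le> T" "1 \<le> T" "w \<in> L" "w \<noteq> 0" "infnorm w \<le> T powr (1 + \<delta>)"
     "p \<le> a" "a < b" "b \<le> q" "p' \<le> a'" "a' < ratio w" "ratio w < b'" "b' \<le> q'"
     and v_small: "\<And>s. s \<in> {a..b} \<Longrightarrow> \<bar>s - ratio v\<bar> * infnorm v ^ ?d \<le> T powr - \<nu>"
     and good: "\<And>s x. s \<in> {a..b} \<union> {a'..b'} \<Longrightarrow> x \<in> pts T \<Longrightarrow> T powr (- \<nu> - \<delta>) < \<bar>s - ratio x\<bar> * abs_prod_coords x"
    using refine_intervals[OF v \<nu> \<delta> S(2,3) U, of K] by blast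
  have "1 \<le> a" "b \<le> 4" using 1 S by linarith+
  then obtain T' w' c c' e e' where 2: "K \<le> T'" "1 \<le> T'" "w' \<in> L" "w' \<noteq> 0" "infnorm w' \<le> T' powr (1 + \<delta>)"
     "a' \<le> c" "c < c'" "c' \<le> b'" "a \<le> e" "e < ratio w'" "ratio w' < e'" "e' \<le> b"
     and w_small: "\<And>u. u \<in> {c..c'} \<Longrightarrow> \<bar>u - ratio w\<bar> * infnorm w ^ ?d \<le> T' powr - \<nu>"
    using refine_intervals[OF 1(3,4) \<nu> \<delta> 1(10,11) _ 1(7), of K] by blast
  define \<tau> where "\<tau> = T' powr (1 + \<delta>)"
  have "T' powr 1 \<le> \<tau>" unfolding \<tau>_def using \<delta> 2(2) by (intro powr_mono) auto
  then have \<tau>: "K \<le> \<tau>" using 2(1,2) by simp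
  have cov: "covers (\<nu> / (1 + \<delta>)) s u t"
    if su: "s \<in> {e..e'}" "u \<in> {c..c'}" and t: "infnorm v \<le> t" "1 \<le> t" "t \<le> \<tau>" for s u t
  proof (cases "t \<le> T powr (1 + \<delta>)")
    case True
    have "min \<bar>s - ratio v\<bar> \<bar>u - ratio v\<bar> * infnorm v ^ ?d \<le> \<bar>s - ratio v\<bar> * infnorm v ^ ?d"
      by (intro mult_right_mono) (auto simp: infnorm_pos_le)
    also have "\<dots> \<le> T powr - \<nu>" using v_small[of s] su 2 by auto
    also have "\<dots> \<le> t powr (- \<nu> / (1 + \<delta>))" by (rule powr_cover[OF t(2) 1(2) True \<nu> \<delta>(1)])
    finally show ?thesis unfolding covers_def using v t by (intro bexI[of _ v]) (auto simp: pts_def)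
  next
    case False
    have "min \<bar>s - ratio w\<bar> \<bar>u - ratio w\<bar> * infnorm w ^ ?d \<le> \<bar>u - ratio w\<bar> * infnorm w ^ ?d"
      by (intro mult_right_mono) (auto simp: infnorm_pos_le)
    also have "\<dots> \<le> T' powr - \<nu>" using w_small[of u] su by auto
    also have "\<dots> \<le> t powr (- \<nu> / (1 + \<delta>))"
      by (rule powr_cover[OF t(2) 2(2) _ \<nu> \<delta>(1)]) (use t(3) in \<open>simp add: \<tau>_def\<close>)
    finally show ?thesis unfolding covers_def using 1 False by (intro bexI[of _ w]) (auto simp: pts_def)
  qed
  \<comment> \<open>The lower bound comes from the first refinement, whose two intervals contain the
    final ones.\<close>
  have "sharp (\<nu> + \<delta>) s u T" if su: "s \<in> {e..e'}" "u \<in> {c..c'}" for s u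
  proof -
    have "s \<in> {a..b} \<union> {a'..b'}" "u \<in> {a..b} \<union> {a'..b'}"
      using su 2(6,8,9,12) by auto
    then show ?thesis unfolding sharp_def using good by (simp del: Un_iff)
  qed
  moreover have "max 1 K \<le> T" using 1 by simp
  ultimately have "\<forall>s\<in>{e..e'}. \<forall>u\<in>{c..c'}.
      (\<forall>t. infnorm v \<le> t \<longrightarrow> 1 \<le> t \<longrightarrow> t \<le> \<tau> \<longrightarrow> covers (\<nu> / (1 + \<delta>)) s u t)
        \<and> (\<exists>T\<ge>max 1 K. sharp (\<nu> + \<delta>) s u T)"
    using cov by blast
  moreover have "p \<le> e" "e' \<le> q" "p' \<le> c" "c' \<le> q'" using 1 2 by linarith+
  ultimately show ?thesis using 2(3,4,5,7,10,11) \<tau> unfolding \<tau>_def[symmetric]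
    by (intro exI[of _ w'] exI[of _ e] exI[of _ e'] exI[of _ c] exI[of _ c'] exI[of _ \<tau>]) blast
qed

text \<open>Provides the starting point of the iteration: a refinement around any lattice point,
  with target interval from 1 to 2, yields a ratio there.\<close>

lemma ex_ratio_between_1_2:
  obtains v where "v \<in> L" "v \<noteq> 0" "1 < ratio v" "ratio v < 2"
proof -
  obtain x where x: "x \<in> L" "x \<noteq> 0" using full_rank_lattice_nonzero[OF lattice] .
  have "\<exists>w\<in>L. w \<noteq> 0 \<and> 1 < ratio w \<and> ratio w < 2"
    using refine_intervals[OF x, of 0 1 "ratio x - 1" "ratio x + 1" 1 2 0] by fastforce
  then show ?thesis using that by blast
qed

text \<open>The slopes are common points of nested closed intervals obtained by dependent choice,
  with losses \<open>del n\<close> tending to 0. The windows from \<open>infnorm (v n)\<close> to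
  \<open>\<tau> n\<close> overlap and their right ends are unbounded, so they cover all large
  times.\<close>

lemma ex_slopes:
  assumes \<nu>: "\<nu> \<ge> 0"
  obtains s u where "1 \<le> s" "s \<le> 2" "3 \<le> u" "u \<le> 4"
    "\<And>\<delta>. 0 < \<delta> \<Longrightarrow> eventually (covers (\<nu> / (1 + \<delta>)) s u) at_top"
    "\<And>\<delta> K. 0 < \<delta> \<Longrightarrow> \<exists>T\<ge>K. 1 \<le> T \<and> sharp (\<nu> + \<delta>) s u T"
proof -
  \<comment> \<open>A state holds the current point, an interval around its ratio for
    \<open>s\<close>, and an interval for \<open>u\<close>.\<close>
  define st where "st = (\<lambda>(v, p, q, p', q'). v \<in> L \<and> v \<noteq> 0 \<and> 1 \<le> p \<and> p < ratio v \<and> ratio v < q \<and> q \<le> 2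
     \<and> 3 \<le> p' \<and> p' < q' \<and> q' \<le> (4::real))"
  define del where "del = (\<lambda>n. 1 / (real n + 1))"
  define nx where "nx = (\<lambda>n (v :: real ^ 'n, p, q, p', q') (v' :: real ^ 'n, a, b, a', b'). p \<le> a \<and> b \<le> q \<and> p' \<le> a' \<and> b' \<le> q' \<and>
     (\<exists>\<tau>\<ge>real n. infnorm v' \<le> \<tau> \<and>
       (\<forall>s\<in>{a..b}. \<forall>u\<in>{a'..b'}.
          (\<forall>t. infnorm v \<le> t \<longrightarrow> 1 \<le> t \<longrightarrow> t \<le> \<tau> \<longrightarrow> covers (\<nu> / (1 + del n)) s u t)
        \<and> (\<exists>T\<ge>max 1 (real n). sharp (\<nu> + del n) s u T))))"
  have "\<exists>f. \<forall>n. st (f n) \<and> nx n (f n) (f (Suc n))"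
  proof (intro dependent_nat_choice)
    obtain v where "v \<in> L" "v \<noteq> 0" "1 < ratio v" "ratio v < 2" using ex_ratio_between_1_2 .
    then show "\<exists>x. st x" by (intro exI[of _ "(v, 1, 2, 3, 4)"]) (simp add: st_def)
  next
    fix x n assume "st x"
    obtain v p q p' q' where x: "x = (v, p, q, p', q')" by (cases x) auto
    have del: "0 < del n" "del n \<le> 1" by (auto simp: del_def)
    have v: "v \<in> L" "v \<noteq> 0" "1 \<le> p" "p < ratio v" "ratio v < q" "q \<le> 4" "1 \<le> p'" "p' < q'" "q' \<le> 4"
      and bd: "q \<le> 2" "3 \<le> p'"
      using \<open>st x\<close> unfolding st_def x by auto
    obtain v' a b a' b' \<tau> where *: "v' \<in> L" "v' \<noteq> 0" "p \<le> a" "a < ratio v'" "ratio v' < b" "b \<le> q"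
      "p' \<le> a'" "a' < b'" "b' \<le> q'" "real n \<le> \<tau>" "infnorm v' \<le> \<tau>"
      "\<forall>s\<in>{a..b}. \<forall>u\<in>{a'..b'}. (\<forall>t. infnorm v \<le> t \<longrightarrow> 1 \<le> t \<longrightarrow> t \<le> \<tau> \<longrightarrow> covers (\<nu> / (1 + del n)) s u t)
        \<and> (\<exists>T\<ge>max 1 (real n). sharp (\<nu> + del n) s u T)"
      using refine_intervals_twice[OF v(1,2) \<nu> del v(3-9), of "real n"] by blast
    have "st (v', a, b, a', b')" unfolding st_def using * v bd by auto
    moreover have "nx n x (v', a, b, a', b')" unfolding nx_def x using *
      by (simp only: case_prod_conv) blast
    ultimately show "\<exists>y. st y \<and> nx n x y" by blast
  qed
  then obtain f where f: "\<And>n. st (f n)" "\<And>n. nx n (f n) (f (Suc n))" by blast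
  define v where "v = (\<lambda>n. fst (f n))"
  define p where "p = (\<lambda>n. fst (snd (f n)))"
  define q where "q = (\<lambda>n. fst (snd (snd (f n))))"
  define p' where "p' = (\<lambda>n. fst (snd (snd (snd (f n)))))"
  define q' where "q' = (\<lambda>n. snd (snd (snd (snd (f n)))))"
  have f_eq: "f n = (v n, p n, q n, p' n, q' n)" for n
    by (simp add: v_def p_def q_def p'_def q'_def)
  have inv: "v n \<in> L" "1 \<le> p n" "p n \<le> q n" "q n \<le> 2" "3 \<le> p' n" "p' n \<le> q' n" "q' n \<le> 4" for n
    using f(1)[of n] unfolding st_def f_eq by auto
  have mono: "p n \<le> p (Suc n)" "q (Suc n) \<le> q n" "p' n \<le> p' (Suc n)" "q' (Suc n) \<le> q' n" for n
    using f(2)[of n] unfolding nx_def f_eq by auto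
  have "\<forall>n. \<exists>\<tau>\<ge>real n. infnorm (v (Suc n)) \<le> \<tau> \<and>
       (\<forall>s\<in>{p (Suc n)..q (Suc n)}. \<forall>u\<in>{p' (Suc n)..q' (Suc n)}.
          (\<forall>t. infnorm (v n) \<le> t \<longrightarrow> 1 \<le> t \<longrightarrow> t \<le> \<tau> \<longrightarrow> covers (\<nu> / (1 + del n)) s u t)
        \<and> (\<exists>T\<ge>max 1 (real n). sharp (\<nu> + del n) s u T))"
    using f(2) unfolding nx_def f_eq by (simp only: case_prod_conv) blast
  then obtain \<tau> where \<tau>: "\<And>n. real n \<le> \<tau> n" "\<And>n. infnorm (v (Suc n)) \<le> \<tau> n"
    and step: "\<And>n. \<forall>s\<in>{p (Suc n)..q (Suc n)}. \<forall>u\<in>{p' (Suc n)..q' (Suc n)}.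
          (\<forall>t. infnorm (v n) \<le> t \<longrightarrow> 1 \<le> t \<longrightarrow> t \<le> \<tau> n \<longrightarrow> covers (\<nu> / (1 + del n)) s u t)
        \<and> (\<exists>T\<ge>max 1 (real n). sharp (\<nu> + del n) s u T)"
    by metis
  have nested: "\<exists>z. \<forall>n. z \<in> {l n..r n}"
    if "\<And>n. l n \<le> l (Suc n)" "\<And>n. r (Suc n) \<le> r n" "\<And>n. l n \<le> (r n :: real)" for l r :: "nat \<Rightarrow> real"
  proof -
    have lr: "l m \<le> r n" for m n
      using lift_Suc_mono_le[of l m "max m n"] lift_Suc_antimono_le[of r n "max m n"] that
      by (meson max.cobounded1 max.cobounded2 order.trans)
    have "l n \<le> (SUP n. l n)" for n by (intro cSUP_upper) (use lr[of _ 0] in \<open>auto intro!: bdd_aboveI\<close>)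
    moreover have "(SUP n. l n) \<le> r n" for n by (intro cSUP_least) (use lr in auto)
    ultimately show ?thesis by auto
  qed
  obtain s where s: "\<And>n. s \<in> {p n..q n}" using nested[of p q] mono inv by blast
  obtain u where u: "\<And>n. u \<in> {p' n..q' n}" using nested[of p' q'] mono inv by blast
  have cov: "covers (\<nu> / (1 + del n)) s u t" if "infnorm (v n) \<le> t" "1 \<le> t" "t \<le> \<tau> n" for n t
    using step[of n] s[of "Suc n"] u[of "Suc n"] that by blast
  have shp: "\<exists>T\<ge>max 1 (real n). sharp (\<nu> + del n) s u T" for n
    using step[of n] s[of "Suc n"] u[of "Suc n"] by blast
  have del_le: "\<exists>N. \<forall>n\<ge>N. del n \<le> \<delta>" if "\<delta> > 0" for \<delta>
  proof -
    obtain N where N: "1 / \<delta> \<le> real N" using real_arch_simple by blast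
    have "del n \<le> \<delta>" if "n \<ge> N" for n
    proof -
      have "1 / \<delta> \<le> real n + 1" using N that by simp
      then show ?thesis unfolding del_def using \<open>\<delta> > 0\<close> by (simp add: field_simps)
    qed
    then show ?thesis by blast
  qed
  show ?thesis
  proof
    show "1 \<le> s" "s \<le> 2" "3 \<le> u" "u \<le> 4" using s[of 0] u[of 0] inv[of 0] by auto
  next
    fix \<delta> :: real assume \<delta>: "0 < \<delta>"
    obtain N where N: "\<And>n. n \<ge> N \<Longrightarrow> del n \<le> \<delta>" using del_le[OF \<delta>] by blast
    \<comment> \<open>The threshold exceeds \<open>\<tau> n\<close> for all
      \<open>n \<le> N\<close>, so the window found for \<open>t\<close> has an index above
      \<open>N\<close> and a loss at most \<open>\<delta>\<close>.\<close>
    have "covers (\<nu> / (1 + \<delta>)) s u t" if t: "t \<ge> 1 + (\<Sum>n\<le>N. \<bar>\<tau> n\<bar>)" for t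
    proof -
      have t_gt: "t > \<tau> n" if "n \<le> N" for n
        using member_le_sum[of n "{..N}" "\<lambda>n. \<bar>\<tau> n\<bar>"] that t by auto
      have "0 \<le> (\<Sum>n\<le>N. \<bar>\<tau> n\<bar>)" by (intro sum_nonneg) simp
      then have t1: "t \<ge> 1" using t by linarith
      obtain m where "t \<le> real m" using real_arch_simple by blast
      then have ex: "\<exists>k. t \<le> \<tau> k" using \<tau>(1)[of m] by (meson order.trans)
      \<comment> \<open>By minimality \<open>t\<close> exceeds the preceding \<open>\<tau>\<close>,
        hence also the norm of \<open>v k\<close>, and lies in the window of index
        \<open>k\<close>.\<close>
      define k where "k = (LEAST k. t \<le> \<tau> k)"
      have k: "t \<le> \<tau> k" unfolding k_def using ex by (rule LeastI_ex)
      then have kN: "k > N" using t_gt[of k] by (meson leD not_le_imp_less)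
      then obtain k' where k': "k = Suc k'" by (cases k) auto
      have "\<not> t \<le> \<tau> k'" using not_less_Least[of k' "\<lambda>k. t \<le> \<tau> k"] k' unfolding k_def by simp
      then have "infnorm (v k) \<le> t" using \<tau>(2)[of k'] k' by simp
      then have "covers (\<nu> / (1 + del k)) s u t" using cov[of k t] t1 k by blast
      moreover have "t powr - (\<nu> / (1 + del k)) \<le> t powr - (\<nu> / (1 + \<delta>))"
      proof (intro powr_mono)
        have "0 < del k" "del k \<le> \<delta>" using N[of k] kN by (auto simp: del_def)
        then show "- (\<nu> / (1 + del k)) \<le> - (\<nu> / (1 + \<delta>))"
          using \<nu> by (simp add: divide_left_mono)
      qed (use t1 in auto)
      ultimately show ?thesis unfolding covers_def using order.trans by blast
    qed
    then show "eventually (covers (\<nu> / (1 + \<delta>)) s u) at_top"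
      by (intro eventually_at_top_linorderI[of "1 + (\<Sum>n\<le>N. \<bar>\<tau> n\<bar>)"]) auto
  next
    fix \<delta> K :: real assume \<delta>: "0 < \<delta>"
    obtain N where N: "\<And>n. n \<ge> N \<Longrightarrow> del n \<le> \<delta>" using del_le[OF \<delta>] by blast
    obtain m where m: "K \<le> real m" using real_arch_simple by blast
    obtain T where T: "T \<ge> max 1 (real (max m N))" "sharp (\<nu> + del (max m N)) s u T"
      using shp[of "max m N"] by blast
    have "T powr - (\<nu> + \<delta>) \<le> T powr - (\<nu> + del (max m N))"
      using T(1) N[of "max m N"] by (intro powr_mono) auto
    then have "sharp (\<nu> + \<delta>) s u T" using T(2) unfolding sharp_def by (meson le_less_trans)
    then show "\<exists>T\<ge>K. 1 \<le> T \<and> sharp (\<nu> + \<delta>) s u T" using T(1) m by (intro exI[of _ T]) auto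
  qed
qed

section \<open>The sheared lattice\<close>

definition shear :: "real \<Rightarrow> real \<Rightarrow> real ^ 'n \<Rightarrow> real ^ 'n" where
  "shear s u x = (\<chi> k. if k = i then x $ i - s * x $ j else if k = j then x $ i - u * x $ j else x $ k)"

lemma shear_nth:
  "shear s u x $ i = x $ i - s * x $ j" "shear s u x $ j = x $ i - u * x $ j"
  "k \<noteq> i \<Longrightarrow> k \<noteq> j \<Longrightarrow> shear s u x $ k = x $ k"
  using ij by (auto simp: shear_def)

lemma linear_shear: "linear (shear s u)"
  by (rule linearI) (auto simp: shear_def vec_eq_iff algebra_simps)

lemma abs_prod_coords_shear:
  assumes "x \<in> L" "x \<noteq> 0"
  shows "abs_prod_coords (shear s u x)
    = \<bar>s - ratio x\<bar> * \<bar>u - ratio x\<bar> * \<bar>x $ j\<bar>\<^sup>2 * (\<Prod>k\<in>UNIV - {i, j}. \<bar>x $ k\<bar>)"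
proof -
  have xj: "x $ j \<noteq> 0" using coord_nonzero assms by blast
  have *: "\<bar>x $ i - r * x $ j\<bar> = \<bar>r - ratio x\<bar> * \<bar>x $ j\<bar>" for r
  proof -
    have "x $ i - r * x $ j = - ((r - ratio x) * x $ j)" using xj by (simp add: ratio_def field_simps)
    then show ?thesis by (metis abs_minus abs_mult)
  qed
  have "(\<Prod>k\<in>UNIV - {i, j}. \<bar>shear s u x $ k\<bar>) = (\<Prod>k\<in>UNIV - {i, j}. \<bar>x $ k\<bar>)"
    by (intro prod.cong) (auto simp: shear_nth)
  then show ?thesis unfolding abs_prod_coords_split[of "shear s u x"] shear_nth *
    by (simp add: power2_eq_square mult_ac)
qed

section \<open>Effect of the shear on norms and products\<close>

context
  fixes s u :: real
  assumes s: "1 \<le> s" "s \<le> 2" and u: "3 \<le> u" "u \<le> 4"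
begin

lemma infnorm_shear_le: "infnorm (shear s u x) \<le> 5 * infnorm x"
  unfolding infnorm_le_iff_cart
proof
  fix k
  have c: "\<bar>x $ l\<bar> \<le> infnorm x" for l by (rule component_le_infnorm_cart)
  have "\<bar>s * x $ j\<bar> \<le> 4 * infnorm x" "\<bar>u * x $ j\<bar> \<le> 4 * infnorm x"
    unfolding abs_mult using s u c[of j] by (intro mult_mono; simp)+
  then have "\<bar>x $ i - s * x $ j\<bar> \<le> 5 * infnorm x" "\<bar>x $ i - u * x $ j\<bar> \<le> 5 * infnorm x"
    using c[of i] by linarith+
  moreover have "\<bar>x $ k\<bar> \<le> 5 * infnorm x" using c[of k] by linarith
  ultimately show "\<bar>shear s u x $ k\<bar> \<le> 5 * infnorm x" by (simp add: shear_def)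
qed

text \<open>The slopes differ by at least 1, so the difference of the two sheared coordinates
  controls \<open>x $ j\<close>, and then the first of them controls \<open>x $ i\<close>.\<close>

lemma infnorm_le_shear: "infnorm x \<le> 5 * infnorm (shear s u x)"
  unfolding infnorm_le_iff_cart
proof
  fix k
  let ?y = "shear s u x"
  have c: "\<bar>?y $ l\<bar> \<le> infnorm ?y" for l by (rule component_le_infnorm_cart)
  have "(u - s) * x $ j = ?y $ i - ?y $ j" by (simp add: shear_nth algebra_simps)
  then have "\<bar>(u - s) * x $ j\<bar> \<le> 2 * infnorm ?y" using c[of i] c[of j] by linarith
  moreover have "1 * \<bar>x $ j\<bar> \<le> \<bar>u - s\<bar> * \<bar>x $ j\<bar>" using s u by (intro mult_right_mono) auto
  ultimately have xj: "\<bar>x $ j\<bar> \<le> 2 * infnorm ?y" unfolding abs_mult by linarith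
  have "\<bar>s * x $ j\<bar> \<le> 2 * (2 * infnorm ?y)" unfolding abs_mult using s xj by (intro mult_mono) auto
  moreover have "x $ i = ?y $ i + s * x $ j" by (simp add: shear_nth)
  ultimately have xi: "\<bar>x $ i\<bar> \<le> 5 * infnorm ?y" using c[of i] by linarith
  have "k \<noteq> i \<Longrightarrow> k \<noteq> j \<Longrightarrow> \<bar>x $ k\<bar> \<le> 5 * infnorm ?y"
    using c[of k] by (simp add: shear_nth)
  then show "\<bar>x $ k\<bar> \<le> 5 * infnorm ?y" using xi xj by (cases "k = i"; cases "k = j") auto
qed

lemma inj_shear: "inj (shear s u)"
  unfolding linear_injective_0[OF linear_shear]
  using infnorm_le_shear by (metis infnorm_eq_0 infnorm_0 infnorm_pos_le mult_zero_right order_antisym)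

text \<open>The factor of the farther slope, times \<open>x $ j\<close>, is at most 5 times the
  norm, and all remaining coordinates are at most the norm.\<close>

lemma abs_prod_coords_shear_upper:
  assumes x: "x \<in> L" "x \<noteq> 0"
  shows "abs_prod_coords (shear s u x) \<le> 5 * (min \<bar>s - ratio x\<bar> \<bar>u - ratio x\<bar> * infnorm x ^ CARD('n))"
proof -
  let ?m = "infnorm x" and ?d = "CARD('n)"
  have m0: "0 \<le> ?m" by (rule infnorm_pos_le)
  have c: "\<bar>x $ l\<bar> \<le> ?m" for l by (rule component_le_infnorm_cart)
  have xj: "x $ j \<noteq> 0" using coord_nonzero x by blast
  have big: "\<bar>r - ratio x\<bar> * \<bar>x $ j\<bar> \<le> 5 * ?m" if "\<bar>r\<bar> \<le> 4" for r
  proof -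
    have "\<bar>r - ratio x\<bar> * \<bar>x $ j\<bar> = \<bar>r * x $ j - x $ i\<bar>"
      unfolding abs_mult[symmetric] using xj by (simp add: ratio_def left_diff_distrib)
    also have "\<dots> \<le> \<bar>r\<bar> * \<bar>x $ j\<bar> + \<bar>x $ i\<bar>" by (metis abs_mult abs_triangle_ineq4)
    also have "\<dots> \<le> 4 * ?m + ?m" using that c[of i] c[of j] by (intro add_mono mult_mono) auto
    finally show ?thesis by simp
  qed
  have P: "(\<Prod>k\<in>UNIV - {i, j}. \<bar>x $ k\<bar>) \<le> ?m ^ (?d - 2)" by (rule prod_other_coords_le) simp
  have P0: "0 \<le> (\<Prod>k\<in>UNIV - {i, j}. \<bar>x $ k\<bar>)" by (intro prod_nonneg) auto
  have md: "?m ^ ?d = ?m * ?m * ?m ^ (?d - 2)"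
    using card_ge_2 by (metis le_add_diff_inverse power2_eq_square power_add)
  have half: "\<bar>r - ratio x\<bar> * \<bar>r' - ratio x\<bar> * \<bar>x $ j\<bar>\<^sup>2 * (\<Prod>k\<in>UNIV - {i, j}. \<bar>x $ k\<bar>)
      \<le> 5 * (\<bar>r - ratio x\<bar> * ?m ^ ?d)" if r': "\<bar>r'\<bar> \<le> 4" for r r'
  proof -
    have "\<bar>r - ratio x\<bar> * \<bar>r' - ratio x\<bar> * \<bar>x $ j\<bar>\<^sup>2 * (\<Prod>k\<in>UNIV - {i, j}. \<bar>x $ k\<bar>)
        = \<bar>r - ratio x\<bar> * ((\<bar>r' - ratio x\<bar> * \<bar>x $ j\<bar>) * \<bar>x $ j\<bar> * (\<Prod>k\<in>UNIV - {i, j}. \<bar>x $ k\<bar>))"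
      by (simp add: power2_eq_square mult_ac)
    also have "\<dots> \<le> \<bar>r - ratio x\<bar> * ((5 * ?m) * ?m * ?m ^ (?d - 2))"
      using m0 P0 by (intro mult_left_mono mult_mono P c big r') auto
    finally show ?thesis unfolding md by (simp add: mult_ac)
  qed
  show ?thesis
  proof (cases "\<bar>s - ratio x\<bar> \<le> \<bar>u - ratio x\<bar>")
    case True
    then show ?thesis unfolding abs_prod_coords_shear[OF x] using half[of u s] u by (simp add: min_def)
  next
    case False
    then show ?thesis unfolding abs_prod_coords_shear[OF x] using half[of s u] s
      by (simp add: min_def mult.commute mult.left_commute)
  qed
qed

text \<open>Multiplied by \<open>\<bar>r\<bar>\<close>, the sheared product is
  \<open>\<bar>s - r\<bar> * \<bar>u - r\<bar> * N\<close>. If \<open>\<bar>r\<bar>\<close> exceeds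
  8, both distances are at least \<open>\<bar>r\<bar> / 2\<close>; otherwise one of them is at least
  1/2, since the slopes are 1 apart, and the hypothesis bounds the other.\<close>

lemma abs_prod_coords_shear_lower:
  assumes x: "x \<in> L" "x \<noteq> 0" and \<kappa>: "\<kappa> \<le> 1"
    and h: "\<kappa> \<le> \<bar>s - ratio x\<bar> * abs_prod_coords x" "\<kappa> \<le> \<bar>u - ratio x\<bar> * abs_prod_coords x"
  shows "\<kappa> / 16 \<le> abs_prod_coords (shear s u x)"
proof -
  define r where "r = ratio x"
  define N where "N = abs_prod_coords x"
  have N1: "N \<ge> 1" unfolding N_def by (rule norm_ge_1[OF x])
  have xij: "x $ i \<noteq> 0" "x $ j \<noteq> 0" using coord_nonzero x by blast+
  then have r0: "\<bar>r\<bar> > 0" by (simp add: r_def ratio_def)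
  have eq: "\<bar>r\<bar> * abs_prod_coords (shear s u x) = \<bar>s - r\<bar> * \<bar>u - r\<bar> * N"
  proof -
    have ri: "\<bar>r\<bar> * \<bar>x $ j\<bar> = \<bar>x $ i\<bar>" using xij by (simp add: r_def ratio_def)
    show ?thesis unfolding abs_prod_coords_shear[OF x] N_def abs_prod_coords_split[of x] r_def[symmetric] ri[symmetric]
      by (simp add: power2_eq_square mult_ac)
  qed
  have "\<bar>r\<bar> * (\<kappa> / 16) \<le> \<bar>s - r\<bar> * \<bar>u - r\<bar> * N"
  proof (cases "\<bar>r\<bar> \<le> 8")
    case False
    have "\<bar>r\<bar> / 2 \<le> \<bar>s - r\<bar>" "\<bar>r\<bar> / 2 \<le> \<bar>u - r\<bar>" using False s u by linarith+
    then have "(\<bar>r\<bar> / 2) * (\<bar>r\<bar> / 2) * 1 \<le> \<bar>s - r\<bar> * \<bar>u - r\<bar> * N"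
      using N1 by (intro mult_mono) auto
    then have "\<bar>r\<bar> * (\<bar>r\<bar> / 4) \<le> \<bar>s - r\<bar> * \<bar>u - r\<bar> * N" by simp
    moreover have "\<bar>r\<bar> * (\<kappa> / 16) \<le> \<bar>r\<bar> * (\<bar>r\<bar> / 4)" using False \<kappa> by (intro mult_left_mono) auto
    ultimately show ?thesis by linarith
  next
    case True
    have *: "\<bar>r\<bar> * (\<kappa> / 16) \<le> 1 / 2 * y" if "\<kappa> \<le> y" "0 \<le> y" for y
    proof -
      have "\<bar>r\<bar> * (\<kappa> / 16) \<le> \<bar>r\<bar> * (y / 16)" using that by (intro mult_left_mono) auto
      also have "\<dots> \<le> 8 * (y / 16)" using that True by (intro mult_right_mono) auto
      finally show ?thesis by simp
    qed
    show ?thesis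
    proof (cases "\<bar>s - r\<bar> \<le> 1 / 2")
      case True
      then have "1 / 2 \<le> \<bar>u - r\<bar>" using s u by linarith
      then have "1 / 2 * (\<bar>s - r\<bar> * N) \<le> \<bar>u - r\<bar> * (\<bar>s - r\<bar> * N)"
        using N1 by (intro mult_right_mono) auto
      moreover have "\<bar>r\<bar> * (\<kappa> / 16) \<le> 1 / 2 * (\<bar>s - r\<bar> * N)"
        using h(1) N1 unfolding r_def[symmetric] N_def[symmetric] by (intro *) auto
      moreover have "\<bar>u - r\<bar> * (\<bar>s - r\<bar> * N) = \<bar>s - r\<bar> * \<bar>u - r\<bar> * N" by simp
      ultimately show ?thesis by linarith
    next
      case False
      then have "1 / 2 * (\<bar>u - r\<bar> * N) \<le> \<bar>s - r\<bar> * (\<bar>u - r\<bar> * N)"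
        using N1 by (intro mult_right_mono) auto
      moreover have "\<bar>r\<bar> * (\<kappa> / 16) \<le> 1 / 2 * (\<bar>u - r\<bar> * N)"
        using h(2) N1 unfolding r_def[symmetric] N_def[symmetric] by (intro *) auto
      moreover have "\<bar>s - r\<bar> * (\<bar>u - r\<bar> * N) = \<bar>s - r\<bar> * \<bar>u - r\<bar> * N" by simp
      ultimately show ?thesis by linarith
    qed
  qed
  then have "\<bar>r\<bar> * (\<kappa> / 16) \<le> \<bar>r\<bar> * abs_prod_coords (shear s u x)" unfolding eq .
  then show ?thesis using r0 by simp
qed

end

text \<open>The slopes are taken for \<open>d * \<omega>\<close> because \<open>geo_prod\<close> is
  a d-th root. \<open>covers\<close> bounds the minimum from above at all large times,
  \<open>sharp\<close> from below at arbitrarily large ones.\<close>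

lemma ex_lattice_exponent:
  assumes \<omega>: "\<omega> \<ge> 0"
  shows "\<exists>M. full_rank_lattice M \<and> weak_uniform_exponent (M :: (real ^ 'n) set) = ereal \<omega>"
proof -
  define d where "d = real CARD('n)"
  have d0: "d > 0" by (simp add: d_def)
  obtain s u where s: "1 \<le> s" "s \<le> 2" and u: "3 \<le> u" "u \<le> 4"
    and cov: "\<And>\<delta>. 0 < \<delta> \<Longrightarrow> eventually (covers (d * \<omega> / (1 + \<delta>)) s u) at_top"
    and shp: "\<And>\<delta> K. 0 < \<delta> \<Longrightarrow> \<exists>T\<ge>K. 1 \<le> T \<and> sharp (d * \<omega> + \<delta>) s u T"
    using ex_slopes[of "d * \<omega>"] d0 \<omega> by auto
  define g where "g = shear s u"
  have lin: "linear g" and inj: "inj g" unfolding g_def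
    using linear_shear inj_shear[OF s u] by auto
  define M where "M = g ` L"
  have M: "full_rank_lattice M" unfolding M_def by (rule full_rank_lattice_image[OF lattice lin inj])
  have g0: "g x \<noteq> 0" if "x \<noteq> 0" for x
    using that inj linear_0[OF lin] by (metis injD)
  have geo: "geo_prod (g x) = abs_prod_coords (g x) powr (1 / d)" for x
    by (simp add: geo_prod_eq abs_prod_coords_def d_def)
  have "weak_uniform_exponent M = ereal \<omega>"
  proof (rule weak_uniform_exponent_eqI)
    fix \<gamma> assume \<gamma>: "\<gamma> < \<omega>"
    obtain \<delta> where \<delta>: "\<delta> > 0" "\<gamma> \<le> \<omega> / (1 + \<delta>)"
    proof (cases "\<gamma> \<le> 0")
      case True
      then show ?thesis using that[of 1] \<omega> by simp
    next
      case False
      then show ?thesis using that[of "(\<omega> - \<gamma>) / \<gamma>"] \<gamma> by (simp add: field_simps)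
    qed
    define \<beta> where "\<beta> = \<omega> / (1 + \<delta>)"
    obtain t0 where t0: "\<And>t. t \<ge> t0 \<Longrightarrow> covers (d * \<omega> / (1 + \<delta>)) s u t"
      using cov[OF \<delta>(1)] by (auto simp: eventually_at_top_linorder)
    \<comment> \<open>The point is taken at time \<open>t / 5\<close>, as the shear enlarges norms
      by a factor of at most 5.\<close>
    have "t powr \<gamma> * lattice_psi M t \<le> 5 powr (1 / d) * 5 powr \<beta>" if t: "t \<ge> max 5 (5 * t0)" for t
    proof -
      have t1: "t / 5 \<ge> t0" "t \<ge> 1" "t / 5 > 0" using t by auto
      obtain x where x: "x \<in> pts (t / 5)"
        "min \<bar>s - ratio x\<bar> \<bar>u - ratio x\<bar> * infnorm x ^ CARD('n) \<le> (t / 5) powr - (d * \<beta>)"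
        using t0[OF t1(1)] unfolding covers_def \<beta>_def by auto
      have xL: "x \<in> L" "x \<noteq> 0" "infnorm x \<le> t / 5" using x by (auto simp: pts_def)
      have "infnorm (g x) \<le> t" using infnorm_shear_le[OF s u, of x] xL(3) unfolding g_def by linarith
      then have "lattice_psi M t \<le> geo_prod (g x)"
        using lattice_psi_le[OF M] xL g0 unfolding M_def by blast
      also have "\<dots> \<le> (5 * (t / 5) powr - (d * \<beta>)) powr (1 / d)"
        unfolding geo using abs_prod_coords_shear_upper[OF s u xL(1,2)] x(2) d0 unfolding g_def
        by (intro powr_mono2) (auto simp: abs_prod_coords_def)
      also have "\<dots> = 5 powr (1 / d) * (t / 5) powr - \<beta>"
        using d0 t1 by (simp add: powr_mult powr_powr)
      also have "\<dots> = 5 powr (1 / d) * 5 powr \<beta> * t powr - \<beta>"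
        using t1 by (simp add: powr_divide powr_minus field_simps)
      finally have "t powr \<gamma> * lattice_psi M t \<le> t powr \<gamma> * (5 powr (1 / d) * 5 powr \<beta> * t powr - \<beta>)"
        by (intro mult_left_mono) auto
      also have "\<dots> = 5 powr (1 / d) * 5 powr \<beta> * t powr (\<gamma> - \<beta>)"
        by (simp add: powr_diff powr_minus divide_inverse mult_ac)
      also have "\<dots> \<le> 5 powr (1 / d) * 5 powr \<beta> * t powr 0"
        using t1 \<delta>(2) unfolding \<beta>_def by (intro mult_left_mono powr_mono) auto
      finally show ?thesis using t1 by simp
    qed
    then show "\<exists>C. eventually (\<lambda>t. t powr \<gamma> * lattice_psi M t \<le> C) at_top"
      by (intro exI eventually_at_top_linorderI[of "max 5 (5 * t0)"])
  next
    fix \<gamma> C K assume \<gamma>: "\<omega> < \<gamma>"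
    \<comment> \<open>Half of the gap between \<open>\<gamma>\<close> and \<open>\<omega>\<close> is
      spent on \<open>\<delta>\<close>; the other half makes the bound grow.\<close>
    define \<delta> where "\<delta> = d * (\<gamma> - \<omega>) / 2"
    have \<delta>: "\<delta> > 0" using \<gamma> d0 by (simp add: \<delta>_def)
    obtain x0 where x0: "x0 \<in> L" "x0 \<noteq> 0" using full_rank_lattice_nonzero[OF lattice] .
    define A where "A = 5 powr - \<gamma> * (1 / 16) powr (1 / d)"
    have A0: "A > 0" by (simp add: A_def)
    have "filterlim (\<lambda>T::real. T powr ((\<gamma> - \<omega>) / 2)) at_top at_top" using \<gamma> by real_asymp
    then have "eventually (\<lambda>T. (\<bar>C\<bar> + 1) / A \<le> T powr ((\<gamma> - \<omega>) / 2)) at_top" by (simp add: filterlim_at_top)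
    then obtain T0 where T0: "\<And>T. T \<ge> T0 \<Longrightarrow> (\<bar>C\<bar> + 1) / A \<le> T powr ((\<gamma> - \<omega>) / 2)"
      by (auto simp: eventually_at_top_linorder)
    \<comment> \<open>The witness will be \<open>T / 5\<close>: points of \<open>M\<close> up to
      that norm come from points of \<open>L\<close> of norm at most \<open>T\<close>, and
      \<open>g x0\<close> is among the former.\<close>
    obtain T where T: "T \<ge> max (5 * K) (max T0 (5 * infnorm (g x0)))" "1 \<le> T" "sharp (d * \<omega> + \<delta>) s u T"
      using shp[OF \<delta>] by blast
    define \<kappa> where "\<kappa> = T powr - (d * \<omega> + \<delta>)"
    have "0 \<le> d * \<omega> + \<delta>" using d0 \<omega> \<delta> by simp
    then have \<kappa>1: "\<kappa> \<le> 1" unfolding \<kappa>_def using T(2) powr_mono[of "- (d * \<omega> + \<delta>)" 0 T] by simp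
    have \<kappa>0: "\<kappa> > 0" using T(2) by (simp add: \<kappa>_def)
    have "(\<kappa> / 16) powr (1 / d) \<le> lattice_psi M (T / 5)"
    proof (rule lattice_psi_ge[OF M])
      show "g x0 \<in> M" "g x0 \<noteq> 0" "infnorm (g x0) \<le> T / 5" using x0 g0 T by (auto simp: M_def)
      fix y assume y: "y \<in> M" "y \<noteq> 0" "infnorm y \<le> T / 5"
      then obtain x where x: "x \<in> L" "y = g x" unfolding M_def by blast
      have x_nz: "x \<noteq> 0" using x y linear_0[OF lin] by auto
      have "infnorm x \<le> T" using infnorm_le_shear[OF s u, of x] y(3) unfolding x(2) g_def by linarith
      then have "x \<in> pts T" using x x_nz by (simp add: pts_def)
      then have "\<kappa> \<le> \<bar>s - ratio x\<bar> * abs_prod_coords x" "\<kappa> \<le> \<bar>u - ratio x\<bar> * abs_prod_coords x"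
        using T(3) unfolding sharp_def \<kappa>_def by (auto intro: less_imp_le)
      then have "\<kappa> / 16 \<le> abs_prod_coords (g x)" unfolding g_def
        by (rule abs_prod_coords_shear_lower[OF s u x(1) x_nz \<kappa>1])
      then show "(\<kappa> / 16) powr (1 / d) \<le> geo_prod y" unfolding x(2) geo
        using \<kappa>0 d0 by (intro powr_mono2) auto
    qed
    then have "(T / 5) powr \<gamma> * (\<kappa> / 16) powr (1 / d) \<le> (T / 5) powr \<gamma> * lattice_psi M (T / 5)"
      by (intro mult_left_mono) auto
    moreover have "(T / 5) powr \<gamma> * (\<kappa> / 16) powr (1 / d) = A * T powr ((\<gamma> - \<omega>) / 2)"
    proof -
      have "\<kappa> = T powr (d * (- \<omega> - (\<gamma> - \<omega>) / 2))"
        unfolding \<kappa>_def \<delta>_def by (simp add: algebra_simps)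
      then have "\<kappa> powr (1 / d) = T powr (d * (- \<omega> - (\<gamma> - \<omega>) / 2) * (1 / d))"
        by (simp only: powr_powr)
      also have "\<dots> = T powr (- \<omega> - (\<gamma> - \<omega>) / 2)" using d0 by simp
      finally have \<kappa>d: "\<kappa> powr (1 / d) = T powr (- \<omega> - (\<gamma> - \<omega>) / 2)" .
      have "(\<kappa> / 16) powr (1 / d) = \<kappa> powr (1 / d) * (1 / 16) powr (1 / d)"
        using powr_mult[of \<kappa> "1 / 16" "1 / d"] by simp
      then have e1: "(\<kappa> / 16) powr (1 / d) = T powr (- \<omega> - (\<gamma> - \<omega>) / 2) * (1 / 16) powr (1 / d)"
        unfolding \<kappa>d .
      have e2: "(T / 5) powr \<gamma> = T powr \<gamma> * 5 powr - \<gamma>"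
        using powr_divide[of T 5 \<gamma>] T(2) by (simp only: powr_minus divide_inverse)
      have "\<gamma> + (- \<omega> - (\<gamma> - \<omega>) / 2) = (\<gamma> - \<omega>) / 2" by argo
      then have "T powr \<gamma> * T powr (- \<omega> - (\<gamma> - \<omega>) / 2) = T powr ((\<gamma> - \<omega>) / 2)"
        by (simp only: powr_add[symmetric])
      then show ?thesis unfolding e1 e2 A_def by (simp add: mult_ac)
    qed
    moreover have "C < A * T powr ((\<gamma> - \<omega>) / 2)"
    proof -
      have "\<bar>C\<bar> + 1 \<le> A * T powr ((\<gamma> - \<omega>) / 2)" using T0[of T] T(1) A0 by (simp add: field_simps)
      then show ?thesis by linarith
    qed
    ultimately have "C < (T / 5) powr \<gamma> * lattice_psi M (T / 5)" by linarith
    then show "\<exists>t\<ge>K. C < t powr \<gamma> * lattice_psi M t" using T(1) by (intro exI[of _ "T / 5"]) auto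
  qed
  then show ?thesis using M by blast
qed

end

theorem theorem2:
  assumes "CARD('n::finite) \<ge> 2"
  shows "{weak_uniform_exponent L | L :: (real ^ 'n) set. full_rank_lattice L} = {0..\<infinity>}"
proof (intro equalityI subsetI)
  fix y assume "y \<in> {weak_uniform_exponent L | L :: (real ^ 'n) set. full_rank_lattice L}"
  then show "y \<in> {0..\<infinity>}" using weak_uniform_exponent_nonneg by auto
next
  fix y :: ereal assume y: "y \<in> {0..\<infinity>}"
  have "\<exists>L :: (real ^ 'n) set. full_rank_lattice L \<and> weak_uniform_exponent L = y"
  proof (cases y)
    case (real \<omega>)
    obtain L :: "(real ^ 'n) set" where L: "full_rank_lattice L"
      "\<And>x. x \<in> L \<Longrightarrow> x \<noteq> 0 \<Longrightarrow> 1 \<le> \<bar>\<Prod>i\<in>UNIV. x $ i\<bar>"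
      using ex_norm_lattice[OF assms] by blast
    obtain i j :: 'n where "i \<noteq> j"
      using assms by (metis (full_types) UNIV_I card_2_iff' card_le_Suc0_iff_eq finite not_less_eq_eq numeral_2_eq_2)
    then interpret norm_lattice L i j
      by unfold_locales (use L in \<open>auto simp: abs_prod_coords_def\<close>)
    show ?thesis using ex_lattice_exponent[of \<omega>] real y by simp
  next
    case PInf
    then show ?thesis
      using full_rank_lattice_integer_points weak_uniform_exponent_integer_points[OF assms] by blast
  next
    case MInf
    then show ?thesis using y by simp
  qed
  then show "y \<in> {weak_uniform_exponent L | L :: (real ^ 'n) set. full_rank_lattice L}" by blast
qed

end
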